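(* Let $(M,g)$ be a 4-manifold with a conformally flat metric $g$ of neutral signature $(2,2)$. If $(M,g)$ admits a parallel anti-isometric almost paracomplex structure or a parallel isometric almost paracomplex structure, then the scalar curvature of $g$ is zero.
   Context: An almost paracomplex structure on a smooth 4-manifold $M$ is an endomorphism field $j$ of $TM$ with $j^2=\mathrm{Id}$, $j\neq\mathrm{Id}$, whose $+1$ and $-1$ eigenspaces are both 2-dimensional at each point. It is isometric with respect to $g$ if $g(j\cdot,j\cdot)=g(\cdot,\cdot)$ and anti-isometric if $g(j\cdot,j\cdot)=-g(\cdot,\cdot)$. It is parallel if $\nabla j=0$ for the Levi-Civita connection $\nabla$ of $g$. A metric is conformally flat if $M$ can be covered by local coordinate systems $(X_1,\dots,X_4)$ in which $ds^2=\Omega^2\sum_{k}\pm dX_k^2$ for a non-zero function $\Omega$ on the coordinate neighbourhood. *)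

theory Defs
  imports "HOL-Analysis.Analysis"
begin

section \<open>Smooth maps\<close>

text \<open>Only meant for open \<^term>\<open>S\<close>: the derivatives are full Frechet derivatives.\<close>

fun times_differentiable_on ::
  "nat \<Rightarrow> ('a::real_normed_vector \<Rightarrow> 'b::real_normed_vector) \<Rightarrow> 'a set \<Rightarrow> bool" where
  "times_differentiable_on 0 f S \<longleftrightarrow> continuous_on S f"
| "times_differentiable_on (Suc n) f S \<longleftrightarrow>
     (\<forall>x\<in>S. f differentiable (at x)) \<and>
     (\<forall>v. times_differentiable_on n (\<lambda>x. frechet_derivative f (at x) v) S)"

definition smooth_on ::
  "('a::real_normed_vector \<Rightarrow> 'b::real_normed_vector) \<Rightarrow> 'a set \<Rightarrow> bool" where
  "smooth_on f S \<longleftrightarrow> (\<forall>n. times_differentiable_on n f S)"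

definition partial :: "'n::finite \<Rightarrow> (real^'n \<Rightarrow> real) \<Rightarrow> real^'n \<Rightarrow> real" where
  "partial i f x = frechet_derivative f (at x) (axis i 1)"


section \<open>Smooth manifolds\<close>

text \<open>A chart is a pair of a domain and a coordinate map. The coordinate map is a total function
  whose values outside the domain are irrelevant.\<close>

type_synonym ('a, 'n) chart = "'a set \<times> ('a \<Rightarrow> (real, 'n) vec)"

abbreviation chart_dom :: "('a, 'n::finite) chart \<Rightarrow> 'a set" where
  "chart_dom c \<equiv> fst c"

abbreviation coords :: "('a, 'n::finite) chart \<Rightarrow> 'a \<Rightarrow> real^'n" where
  "coords c \<equiv> snd c"

definition is_chart :: "'a topology \<Rightarrow> ('a, 'n::finite) chart \<Rightarrow> bool" where
  "is_chart M c \<longleftrightarrow>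
     openin M (chart_dom c) \<and> open (coords c ` chart_dom c) \<and>
     homeomorphic_map (subtopology M (chart_dom c))
       (top_of_set (coords c ` chart_dom c)) (coords c)"

definition transition ::
  "('a, 'n::finite) chart \<Rightarrow> ('a, 'n) chart \<Rightarrow> real^'n \<Rightarrow> real^'n" where
  "transition c d = coords d \<circ> inv_into (chart_dom c) (coords c)"

definition overlap :: "('a, 'n::finite) chart \<Rightarrow> ('a, 'n) chart \<Rightarrow> (real^'n) set" where
  "overlap c d = coords c ` (chart_dom c \<inter> chart_dom d)"

definition compatible :: "('a, 'n::finite) chart \<Rightarrow> ('a, 'n) chart \<Rightarrow> bool" where
  "compatible c d \<longleftrightarrow>
     smooth_on (transition c d) (overlap c d) \<and> smooth_on (transition d c) (overlap d c)"

text \<open>The smooth structure \<^term>\<open>A\<close> is the maximal atlas, so that it contains every smooth local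
  coordinate system.\<close>

definition smooth_manifold :: "'a topology \<Rightarrow> ('a, 'n::finite) chart set \<Rightarrow> bool" where
  "smooth_manifold M A \<longleftrightarrow>
     Hausdorff_space M \<and> second_countable M \<and>
     (\<forall>c\<in>A. is_chart M c) \<and>
     (\<Union>c\<in>A. chart_dom c) = topspace M \<and>
     (\<forall>c\<in>A. \<forall>d\<in>A. compatible c d) \<and>
     (\<forall>c. is_chart M c \<and> (\<forall>d\<in>A. compatible c d) \<longrightarrow> c \<in> A)"


section \<open>Tensor fields\<close>

text \<open>A tensor field of type (0,2) or (1,1) is given by its matrix of components in each chart of
  the smooth structure, as a function of the coordinates, subject to the transformation law of the
  respective type. The matrix of a (1,1) field acts on the column of components of a tangent vector.
  Tangent spaces are thus identified with coordinate space by means of a chart.\<close>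

type_synonym ('a, 'n) field2 = "('a, 'n) chart \<Rightarrow> (real, 'n) vec \<Rightarrow> ((real, 'n) vec, 'n) vec"

definition bilinear_field :: "('a, 'n::finite) chart set \<Rightarrow> ('a, 'n) field2 \<Rightarrow> bool" where
  "bilinear_field A g \<longleftrightarrow>
     (\<forall>c\<in>A. smooth_on (g c) (coords c ` chart_dom c)) \<and>
     (\<forall>c\<in>A. \<forall>d\<in>A. \<forall>x\<in>overlap c d.
        g c x = transpose (jacobian (transition c d) (at x)) ** g d (transition c d x) **
                jacobian (transition c d) (at x))"

definition endomorphism_field :: "('a, 'n::finite) chart set \<Rightarrow> ('a, 'n) field2 \<Rightarrow> bool" where
  "endomorphism_field A j \<longleftrightarrow>
     (\<forall>c\<in>A. smooth_on (j c) (coords c ` chart_dom c)) \<and>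
     (\<forall>c\<in>A. \<forall>d\<in>A. \<forall>x\<in>overlap c d.
        jacobian (transition c d) (at x) ** j c x =
        j d (transition c d x) ** jacobian (transition c d) (at x))"


section \<open>Metrics\<close>

definition diagonal :: "('n::finite \<Rightarrow> real) \<Rightarrow> real^'n^'n" where
  "diagonal e = (\<chi> i k. if i = k then e i else 0)"

text \<open>The columns of \<^term>\<open>P\<close> form a pseudo-orthonormal basis.\<close>

definition has_signature :: "real^'n^'n \<Rightarrow> nat \<Rightarrow> nat \<Rightarrow> bool" where
  "has_signature G p q \<longleftrightarrow>
     (\<exists>(P::real^'n^'n) e. invertible P \<and> transpose P ** G ** P = diagonal e \<and> (\<forall>i. e i \<in> {1, -1}) \<and>
        card {i. e i = 1} = p \<and> card {i. e i = -1} = q)"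

text \<open>Since all \<^term>\<open>e i\<close> are nonzero, \<^const>\<open>has_signature\<close> implies that the form is symmetric and
  nondegenerate.\<close>

definition metric_of_signature ::
  "('a, 'n::finite) chart set \<Rightarrow> ('a, 'n) field2 \<Rightarrow> nat \<Rightarrow> nat \<Rightarrow> bool" where
  "metric_of_signature A g p q \<longleftrightarrow>
     bilinear_field A g \<and>
     (\<forall>c\<in>A. \<forall>x\<in>coords c ` chart_dom c. has_signature (g c x) p q)"

definition conformally_flat ::
  "'a topology \<Rightarrow> ('a, 'n::finite) chart set \<Rightarrow> ('a, 'n) field2 \<Rightarrow> bool" where
  "conformally_flat M A g \<longleftrightarrow>
     (\<forall>p\<in>topspace M. \<exists>c\<in>A. p \<in> chart_dom c \<and>
        (\<exists>\<Omega> e. (\<forall>k. e k \<in> {1, -1}) \<and>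
          (\<forall>x\<in>coords c ` chart_dom c. \<Omega> x \<noteq> 0 \<and> g c x = (\<Omega> x)\<^sup>2 *\<^sub>R diagonal e)))"


section \<open>Levi-Civita connection and curvature in coordinates\<close>

text \<open>In this section \<^term>\<open>G\<close> is the component matrix of a metric in one chart.
  \<^term>\<open>christoffel G l i k x\<close> is the coefficient of the \<^term>\<open>l\<close>-th coordinate vector field in the
  covariant derivative of the \<^term>\<open>k\<close>-th one along the \<^term>\<open>i\<close>-th one.\<close>

definition christoffel ::
  "(real^'n \<Rightarrow> real^'n^'n) \<Rightarrow> 'n::finite \<Rightarrow> 'n \<Rightarrow> 'n \<Rightarrow> real^'n \<Rightarrow> real" where
  "christoffel G l i k x =
     (1/2) * (\<Sum>m\<in>UNIV. matrix_inv (G x) $ l $ m *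
       (partial i (\<lambda>y. G y $ k $ m) x + partial k (\<lambda>y. G y $ i $ m) x
        - partial m (\<lambda>y. G y $ i $ k) x))"

lemma partial_cong_open:
  assumes "open S" "x \<in> S" "\<And>y. y \<in> S \<Longrightarrow> f y = h y"
  shows "partial i f x = partial i h x"
proof -
  have "(f has_derivative D) (at x) \<longleftrightarrow> (h has_derivative D) (at x)" for D
    using assms has_derivative_transform_within_open by (smt (verit, best))
  then show ?thesis
    by (simp add: partial_def frechet_derivative_def)
qed

lemma partial_symmetric:
  assumes "open S" "x \<in> S" "\<And>y. y \<in> S \<Longrightarrow> transpose (G y) = G y"
  shows "partial m (\<lambda>y. G y $ i $ k) x = partial m (\<lambda>y. G y $ k $ i) x"
proof (rule partial_cong_open[OF assms(1,2)])
  fix y assume "y \<in> S"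
  then have "transpose (G y) $ k $ i = G y $ k $ i"
    using assms(3) by simp
  then show "G y $ i $ k = G y $ k $ i"
    by (simp add: transpose_def)
qed

text \<open>The following two facts characterise the Levi-Civita connection.\<close>

lemma christoffel_torsion_free:
  assumes "open S" "x \<in> S" "\<And>y. y \<in> S \<Longrightarrow> transpose (G y) = G y"
  shows "christoffel G l i k x = christoffel G l k i x"
  unfolding christoffel_def
  by (intro arg_cong[where f = "\<lambda>t. (1/2) * t"] sum.cong refl)
     (simp add: partial_symmetric[where G = G and S = S and i = i and k = k, OF assms])

lemma christoffel_lower:
  assumes "invertible (G x)"
  shows "(\<Sum>l\<in>UNIV. G x $ k $ l * christoffel G l m i x) =
     (1/2) * (partial m (\<lambda>y. G y $ i $ k) x + partial i (\<lambda>y. G y $ m $ k) x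
        - partial k (\<lambda>y. G y $ m $ i) x)"
proof -
  have inv: "G x ** matrix_inv (G x) = mat 1"
    using someI_ex[OF assms[unfolded invertible_def]] by (simp add: matrix_inv_def)
  define v :: "real^'a" where
    "v = (\<chi> n. partial m (\<lambda>y. G y $ i $ n) x + partial i (\<lambda>y. G y $ m $ n) x
        - partial n (\<lambda>y. G y $ m $ i) x)"
  have chr: "christoffel G l m i x = (1/2) * (matrix_inv (G x) *v v) $ l" for l
    by (simp add: christoffel_def v_def matrix_vector_mult_def)
  have "(\<Sum>l\<in>UNIV. G x $ k $ l * christoffel G l m i x) =
      (1/2) * (G x *v (matrix_inv (G x) *v v)) $ k"
    unfolding chr matrix_vector_mult_def[of "G x"] by (simp add: sum_divide_distrib)
  also have "G x *v (matrix_inv (G x) *v v) = v"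
    using inv by (simp add: matrix_vector_mul_assoc)
  finally show ?thesis
    by (simp add: v_def)
qed

lemma christoffel_metric:
  assumes "open S" "x \<in> S" "\<And>y. y \<in> S \<Longrightarrow> transpose (G y) = G y"
    and "invertible (G x)"
  shows "partial m (\<lambda>y. G y $ i $ k) x =
     (\<Sum>l\<in>UNIV. G x $ l $ k * christoffel G l m i x) +
     (\<Sum>l\<in>UNIV. G x $ i $ l * christoffel G l m k x)"
proof -
  have "G x $ l $ k = G x $ k $ l" for l
    using arg_cong[OF assms(3)[OF assms(2)], of "\<lambda>B. B $ k $ l"] by (simp add: transpose_def)
  then show ?thesis
    using partial_symmetric[where G = G and S = S, OF assms(1-3), of m k i]
      partial_symmetric[where G = G and S = S, OF assms(1-3), of k m i]
      partial_symmetric[where G = G and S = S, OF assms(1-3), of i m k]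
      christoffel_lower[where G = G and x = x, OF assms(4), of k m i]
      christoffel_lower[where G = G and x = x, OF assms(4), of i m k]
    by simp
qed

text \<open>\<^term>\<open>riemann G l k i j x\<close> is the \<^term>\<open>l\<close>-th component of the curvature operator of the
  coordinate vector fields \<^term>\<open>i\<close> and \<^term>\<open>j\<close>, applied to the \<^term>\<open>k\<close>-th one.\<close>

definition riemann ::
  "(real^'n \<Rightarrow> real^'n^'n) \<Rightarrow> 'n::finite \<Rightarrow> 'n \<Rightarrow> 'n \<Rightarrow> 'n \<Rightarrow> real^'n \<Rightarrow> real" where
  "riemann G l k i j x =
     partial i (christoffel G l j k) x - partial j (christoffel G l i k) x +
     (\<Sum>m\<in>UNIV. christoffel G l i m x * christoffel G m j k x
             - christoffel G l j m x * christoffel G m i k x)"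

definition ricci ::
  "(real^'n \<Rightarrow> real^'n^'n) \<Rightarrow> 'n::finite \<Rightarrow> 'n \<Rightarrow> real^'n \<Rightarrow> real" where
  "ricci G j k x = (\<Sum>i\<in>UNIV. riemann G i k i j x)"

definition scalar_curvature :: "(real^'n::finite \<Rightarrow> real^'n^'n) \<Rightarrow> real^'n \<Rightarrow> real" where
  "scalar_curvature G x = (\<Sum>j\<in>UNIV. \<Sum>k\<in>UNIV. matrix_inv (G x) $ j $ k * ricci G j k x)"


section \<open>Almost paracomplex structures on 4-manifolds\<close>

definition almost_paracomplex :: "('a, 4) chart set \<Rightarrow> ('a, 4) field2 \<Rightarrow> bool" where
  "almost_paracomplex A j \<longleftrightarrow>
     endomorphism_field A j \<and>
     (\<forall>c\<in>A. \<forall>x\<in>coords c ` chart_dom c.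
        j c x ** j c x = mat 1 \<and> j c x \<noteq> mat 1 \<and>
        dim {v. j c x *v v = v} = 2 \<and> dim {v. j c x *v v = - v} = 2)"

definition isometric ::
  "('a, 'n::finite) chart set \<Rightarrow> ('a, 'n) field2 \<Rightarrow> ('a, 'n) field2 \<Rightarrow> bool" where
  "isometric A g j \<longleftrightarrow>
     (\<forall>c\<in>A. \<forall>x\<in>coords c ` chart_dom c. \<forall>v w.
        (j c x *v v) \<bullet> (g c x *v (j c x *v w)) = v \<bullet> (g c x *v w))"

definition anti_isometric ::
  "('a, 'n::finite) chart set \<Rightarrow> ('a, 'n) field2 \<Rightarrow> ('a, 'n) field2 \<Rightarrow> bool" where
  "anti_isometric A g j \<longleftrightarrow>
     (\<forall>c\<in>A. \<forall>x\<in>coords c ` chart_dom c. \<forall>v w.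
        (j c x *v v) \<bullet> (g c x *v (j c x *v w)) = - (v \<bullet> (g c x *v w)))"

text \<open>Components of the covariant derivative of an endomorphism field along the \<^term>\<open>m\<close>-th coordinate
  vector field: row \<^term>\<open>i\<close>, column \<^term>\<open>k\<close>.\<close>

definition nabla_endo ::
  "(real^'n \<Rightarrow> real^'n^'n) \<Rightarrow> (real^'n \<Rightarrow> real^'n^'n) \<Rightarrow> 'n::finite \<Rightarrow> 'n \<Rightarrow> 'n \<Rightarrow> real^'n \<Rightarrow> real"
  where
  "nabla_endo G J m i k x =
     partial m (\<lambda>y. J y $ i $ k) x +
     (\<Sum>l\<in>UNIV. christoffel G i m l x * J x $ l $ k) -
     (\<Sum>l\<in>UNIV. christoffel G l m k x * J x $ i $ l)"

definition parallel ::
  "('a, 'n::finite) chart set \<Rightarrow> ('a, 'n) field2 \<Rightarrow> ('a, 'n) field2 \<Rightarrow> bool" where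
  "parallel A g j \<longleftrightarrow>
     (\<forall>c\<in>A. \<forall>x\<in>coords c ` chart_dom c. \<forall>m i k. nabla_endo (g c) (j c) m i k x = 0)"

end

theory Submission
  imports Defs
begin

text \<open>Write $D$ for the Jacobian of the change from a given chart to conformally flat coordinates,
  so that $G = \omega D^T E D$ in the given chart with a constant diagonal matrix $E$ of signs. In the
  coordinate frame of the flat chart the Levi-Civita connection is explicit, and its curvature has the form
  $R_{ij} = \partial_j \otimes p_i - \partial_i \otimes p_j - p_i^\sharp \otimes \partial_j^\flat
  + p_j^\sharp \otimes \partial_i^\flat$. Since $J$ is parallel, $R_{ij} = J R_{ij} J$. Contracting both
  sides to a scalar, and using $\mathrm{tr}\,J = 0$ and $J^T G J = \varepsilon G$, gives
  $(2 - 2n) \tau = 2 \varepsilon \tau$ for $\tau = \mathrm{tr}_g\, p$. Hence $\tau = 0$, and the scalar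
  curvature is a multiple of $\tau$.\<close>

section \<open>Calculus of smooth maps\<close>

text \<open>The tensor p is minus the Schouten tensor. With f = 1/2 log |\<omega>| it is the flat
  Hessian of f, minus df \<otimes> df, plus half of |df|^2 times the flat metric, so the whole
  curvature is encoded in one function. The shape of the proof is dictated by the conclusion: it
  concerns every chart of the maximal atlas, while the metric is diagonal only in special ones. The
  computation therefore stays in the given chart, and the flat coordinates enter only as a moving
  frame. Parallelism is used through equality of mixed derivatives: it gives J R = R J, and
  multiplying by J with J^2 = 1 gives R = J R J. Of the four terms of R, two are then contracted
  into J against the metric or its inverse and return \<epsilon> \<tau> each; the other two acquire
  the factor tr J. What remains is (2n - 2 + 2 \<epsilon>) \<tau> = 0. The coefficient is 2n in the
  isometric and 2n - 4 in the anti-isometric case, so dimension 4 is safe for both signs.\<close>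

definition dird :: "'a::real_normed_vector \<Rightarrow> ('a \<Rightarrow> 'b::real_normed_vector) \<Rightarrow> 'a \<Rightarrow> 'b" where
  "dird v f x = frechet_derivative f (at x) v"

text \<open>\<open>partial\<close> is tied to real functions and coordinate directions;
  \<open>dird\<close> differentiates vector- and matrix-valued functions as a whole, so that product
  rules for matrices replace index computations.\<close>

lemma partial_eq_dird: "partial i f x = dird (axis i 1) f x"
  by (simp add: partial_def dird_def)

lemma dird_eqI: "(f has_derivative F) (at x) \<Longrightarrow> dird v f x = F v"
  by (metis dird_def frechet_derivative_at)

lemma has_derivative_dird:
  "f differentiable (at x) \<Longrightarrow> (f has_derivative (\<lambda>v. dird v f x)) (at x)"
  by (simp add: dird_def frechet_derivative_works)

lemma dird_cong_open:
  assumes "open S" "x \<in> S" "\<And>y. y \<in> S \<Longrightarrow> f y = h y"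
  shows "dird v f x = dird v h x"
proof -
  have "(f has_derivative D) (at x) \<longleftrightarrow> (h has_derivative D) (at x)" for D
    using assms has_derivative_transform_within_open by (smt (verit, best))
  then show ?thesis
    by (simp add: dird_def frechet_derivative_def)
qed

section \<open>Closure properties of finite orders of differentiability\<close>

lemma times_differentiable_on_cong:
  assumes "open S" "\<And>y. y \<in> S \<Longrightarrow> f y = h y" "times_differentiable_on n f S"
  shows "times_differentiable_on n h S"
  using assms(2,3)
proof (induction n arbitrary: f h)
  case 0
  then show ?case
    using continuous_on_cong[of S S f h] by simp
next
  case (Suc n)
  have "h differentiable (at x)" if "x \<in> S" for x
    using Suc.prems that assms(1) has_derivative_transform_within_open
    unfolding times_differentiable_on.simps differentiable_def by (metis (full_types))
  moreover have "times_differentiable_on n (\<lambda>x. frechet_derivative h (at x) v) S" for v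
  proof (rule Suc.IH)
    show "times_differentiable_on n (\<lambda>x. frechet_derivative f (at x) v) S"
      using Suc.prems by simp
    show "frechet_derivative f (at x) v = frechet_derivative h (at x) v" if "x \<in> S" for x
      using dird_cong_open[OF assms(1) that Suc.prems(1)] by (simp add: dird_def)
  qed
  ultimately show ?case
    by simp
qed

lemma times_differentiable_on_Suc_dird:
  "times_differentiable_on (Suc n) f S \<longleftrightarrow>
     (\<forall>x\<in>S. f differentiable (at x)) \<and> (\<forall>v. times_differentiable_on n (dird v f) S)"
  by (simp add: dird_def[abs_def])

declare times_differentiable_on.simps(2)[simp del]

lemma times_differentiable_on_SucD:
  assumes "times_differentiable_on (Suc n) f S"
  shows "x \<in> S \<Longrightarrow> f differentiable (at x)" "times_differentiable_on n (dird v f) S"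
  using assms by (auto simp: times_differentiable_on_Suc_dird)

text \<open>Common induction step of the closure lemmas: a formula \<open>F\<close> for the
  derivative is built from operations already known to preserve order \<open>n\<close>.\<close>

lemma times_differentiable_on_SucI:
  assumes "open S" "\<And>x. x \<in> S \<Longrightarrow> (f has_derivative F x) (at x)"
    "\<And>v. times_differentiable_on n (\<lambda>x. F x v) S"
  shows "times_differentiable_on (Suc n) f S"
  unfolding times_differentiable_on_Suc_dird
proof (intro conjI ballI allI)
  show "f differentiable (at x)" if "x \<in> S" for x
    using assms(2)[OF that] by (rule differentiableI)
  show "times_differentiable_on n (dird v f) S" for v
    using times_differentiable_on_cong[OF assms(1) _ assms(3)] dird_eqI[OF assms(2)] by metis
qed

lemma times_differentiable_on_Suc_mono:
  "times_differentiable_on (Suc n) f S \<Longrightarrow> times_differentiable_on n f S"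
proof (induction n arbitrary: f)
  case 0
  then show ?case
    using times_differentiable_on_SucD(1) continuous_at_imp_continuous_on
      differentiable_imp_continuous_within by (metis times_differentiable_on.simps(1))
next
  case (Suc n)
  from Suc.prems show ?case
    using Suc.IH by (simp add: times_differentiable_on_Suc_dird)
qed

lemma times_differentiable_on_const: "times_differentiable_on n (\<lambda>x. c) S"
  by (induction n arbitrary: c) (auto simp: times_differentiable_on.simps)

lemma times_differentiable_on_bounded_linear:
  assumes "open S" "bounded_linear L"
  shows "times_differentiable_on n f S \<Longrightarrow> times_differentiable_on n (\<lambda>x. L (f x)) S"
proof (induction n arbitrary: f)
  case 0
  then show ?case
    using bounded_linear.continuous_on[OF assms(2)] by simp
next
  case (Suc n)
  show ?case
    by (rule times_differentiable_on_SucI[OF assms(1)])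
      (use Suc in \<open>blast intro: bounded_linear.has_derivative[OF assms(2)] has_derivative_dird
        dest: times_differentiable_on_SucD\<close>)+
qed

lemma times_differentiable_on_add:
  assumes "open S"
  shows "times_differentiable_on n f S \<Longrightarrow> times_differentiable_on n g S \<Longrightarrow>
    times_differentiable_on n (\<lambda>x. f x + g x) S"
proof (induction n arbitrary: f g)
  case 0
  then show ?case
    by (simp add: continuous_on_add)
next
  case (Suc n)
  show ?case
    by (rule times_differentiable_on_SucI[OF assms(1)])
      (use Suc in \<open>blast intro: has_derivative_add has_derivative_dird
        dest: times_differentiable_on_SucD\<close>)+
qed

text \<open>One statement serves scalar multiples, matrix products, matrix-vector products and
  \<open>outer\<close>. The derivative is again a sum of values of \<open>B\<close>, with one factor
  differentiated and the other lowered by one order.\<close>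

lemma times_differentiable_on_bounded_bilinear:
  assumes "open S" and bb: "bounded_bilinear B"
  shows "times_differentiable_on n f S \<Longrightarrow> times_differentiable_on n g S \<Longrightarrow>
    times_differentiable_on n (\<lambda>x. B (f x) (g x)) S"
proof (induction n arbitrary: f g)
  case 0
  then show ?case
    using bounded_bilinear.continuous_on[OF bb] by simp
next
  case (Suc n)
  show ?case
  proof (rule times_differentiable_on_SucI[OF assms(1)])
    show "((\<lambda>x. B (f x) (g x)) has_derivative
        (\<lambda>v. B (f x) (dird v g x) + B (dird v f x) (g x))) (at x)" if "x \<in> S" for x
      using that Suc.prems
      by (intro bounded_bilinear.FDERIV[OF bb] has_derivative_dird times_differentiable_on_SucD)
    show "times_differentiable_on n (\<lambda>x. B (f x) (dird v g x) + B (dird v f x) (g x)) S" for v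
      using Suc.prems
      by (intro times_differentiable_on_add[OF assms(1)] Suc.IH)
        (blast intro: times_differentiable_on_Suc_mono dest: times_differentiable_on_SucD)+
  qed
qed

lemma times_differentiable_on_inverse:
  fixes f :: "'a::real_normed_vector \<Rightarrow> real"
  assumes "open S" and nz: "\<And>x. x \<in> S \<Longrightarrow> f x \<noteq> 0"
  shows "times_differentiable_on n f S \<Longrightarrow> times_differentiable_on n (\<lambda>x. inverse (f x)) S"
proof (induction n)
  case 0
  then show ?case
    using nz by (auto intro: continuous_on_inverse)
next
  case (Suc n)
  \<comment> \<open>The derivative of the reciprocal contains the reciprocal itself, but only at the
    lower order, where the induction hypothesis applies.\<close>
  have i: "times_differentiable_on n (\<lambda>x. inverse (f x)) S"
    using Suc times_differentiable_on_Suc_mono by blast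
  show ?case
  proof (rule times_differentiable_on_SucI[OF assms(1)])
    show "((\<lambda>x. inverse (f x)) has_derivative
        (\<lambda>v. - (inverse (f x) * dird v f x * inverse (f x)))) (at x)" if "x \<in> S" for x
      using that nz Suc.prems
      by (intro Deriv.has_derivative_inverse has_derivative_dird times_differentiable_on_SucD)
    show "times_differentiable_on n (\<lambda>x. - (inverse (f x) * dird v f x * inverse (f x))) S" for v
      using i times_differentiable_on_SucD(2)[OF Suc.prems]
      by (intro times_differentiable_on_bounded_linear[OF assms(1)
            bounded_linear_minus[OF bounded_linear_ident]]
          times_differentiable_on_bounded_bilinear[OF assms(1) bounded_bilinear_mult])
  qed
qed

lemma times_differentiable_on_sum:
  assumes "open S" "\<And>i. i \<in> I \<Longrightarrow> times_differentiable_on n (f i) S"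
  shows "times_differentiable_on n (\<lambda>x. \<Sum>i\<in>I. f i x) S"
  using assms(2)
  by (induction I rule: infinite_finite_induct)
    (auto simp: times_differentiable_on_const intro: times_differentiable_on_add[OF assms(1)])

lemma dird_compose:
  assumes "f differentiable (at x)" "h differentiable (at (f x))"
  shows "dird v (\<lambda>x. h (f x)) x = dird (dird v f x) h (f x)"
  using dird_eqI[OF diff_chain_at[OF has_derivative_dird[OF assms(1)] has_derivative_dird[OF assms(2)]]]
  by (simp add: o_def)

lemma dird_basis_sum:
  fixes f :: "'a::euclidean_space \<Rightarrow> 'b::real_normed_vector"
  assumes "f differentiable (at x)"
  shows "dird v f x = (\<Sum>b\<in>Basis. (v \<bullet> b) *\<^sub>R dird b f x)"
proof -
  have "linear (\<lambda>v. dird v f x)"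
    using has_derivative_dird[OF assms] has_derivative_linear by blast
  then show ?thesis
    using linear_sum[of "\<lambda>v. dird v f x" "\<lambda>b. (v \<bullet> b) *\<^sub>R b" Basis]
    by (simp add: euclidean_representation linear_cmul[of "\<lambda>v. dird v f x"])
qed

text \<open>In the chain rule the direction in which \<open>h\<close> is differentiated varies with
  the point, whereas orders of differentiability speak of constant directions. Expanding that
  direction in \<open>Basis\<close> separates the two, which is why the middle space is
  Euclidean.\<close>

lemma times_differentiable_on_compose:
  fixes f :: "'a::real_normed_vector \<Rightarrow> 'c::euclidean_space"
  assumes "open S" "f ` S \<subseteq> T"
  shows "times_differentiable_on n f S \<Longrightarrow> times_differentiable_on n h T \<Longrightarrow>
    times_differentiable_on n (\<lambda>x. h (f x)) S"
proof (induction n arbitrary: h)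
  case 0
  then show ?case
    using continuous_on_compose2[of T h S f] assms(2) by simp
next
  case (Suc n)
  have fh: "f differentiable (at x)" "h differentiable (at (f x))" if "x \<in> S" for x
  proof -
    show "f differentiable (at x)"
      using times_differentiable_on_SucD(1)[OF Suc.prems(1) that] .
    have "f x \<in> T" using that assms(2) by blast
    then show "h differentiable (at (f x))"
      by (rule times_differentiable_on_SucD(1)[OF Suc.prems(2)])
  qed
  show "times_differentiable_on (Suc n) (\<lambda>x. h (f x)) S"
  proof (rule times_differentiable_on_SucI[OF assms(1), where
        F = "\<lambda>x v. \<Sum>b\<in>Basis. (dird v f x \<bullet> b) *\<^sub>R dird b h (f x)"])
    show "((\<lambda>x. h (f x)) has_derivative
        (\<lambda>v. \<Sum>b\<in>Basis. (dird v f x \<bullet> b) *\<^sub>R dird b h (f x))) (at x)" if "x \<in> S" for x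
      using diff_chain_at[OF has_derivative_dird[OF fh(1)[OF that]] has_derivative_dird[OF fh(2)[OF that]]]
      by (simp add: o_def dird_basis_sum[OF fh(2)[OF that], symmetric])
    show "times_differentiable_on n (\<lambda>x. \<Sum>b\<in>Basis. (dird v f x \<bullet> b) *\<^sub>R dird b h (f x)) S" for v
    proof (intro times_differentiable_on_sum[OF assms(1)]
        times_differentiable_on_bounded_bilinear[OF assms(1) bounded_bilinear_scaleR])
      fix b :: 'c
      show "times_differentiable_on n (\<lambda>x. dird v f x \<bullet> b) S"
        using times_differentiable_on_bounded_linear[OF assms(1) bounded_linear_inner_left]
          times_differentiable_on_SucD(2)[OF Suc.prems(1)] .
      show "times_differentiable_on n (\<lambda>x. dird b h (f x)) S"
        using Suc.IH[OF times_differentiable_on_Suc_mono[OF Suc.prems(1)]]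
          times_differentiable_on_SucD(2)[OF Suc.prems(2)] .
    qed
  qed
qed

lemma times_differentiable_on_subset:
  "times_differentiable_on n f T \<Longrightarrow> S \<subseteq> T \<Longrightarrow> times_differentiable_on n f S"
  by (induction n arbitrary: f)
    (auto simp: times_differentiable_on_Suc_dird intro: continuous_on_subset)

section \<open>Rules for smooth maps and for directional derivatives\<close>

lemma smooth_on_subset: "smooth_on f T \<Longrightarrow> S \<subseteq> T \<Longrightarrow> smooth_on f S"
  using times_differentiable_on_subset unfolding smooth_on_def by metis

lemma smooth_on_cong:
  "open S \<Longrightarrow> (\<And>y. y \<in> S \<Longrightarrow> f y = h y) \<Longrightarrow> smooth_on f S \<Longrightarrow> smooth_on h S"
  unfolding smooth_on_def using times_differentiable_on_cong by metis

lemma smooth_on_differentiable: "smooth_on f S \<Longrightarrow> x \<in> S \<Longrightarrow> f differentiable (at x)"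
  unfolding smooth_on_def by (metis times_differentiable_on.simps(2))

lemma smooth_on_continuous_on: "smooth_on f S \<Longrightarrow> continuous_on S f"
  unfolding smooth_on_def by (metis times_differentiable_on.simps(1))

lemma smooth_on_dird: "smooth_on f S \<Longrightarrow> smooth_on (dird v f) S"
  unfolding smooth_on_def by (metis times_differentiable_on_Suc_dird)

lemma smooth_on_const: "smooth_on (\<lambda>x. c) S"
  by (simp add: smooth_on_def times_differentiable_on_const)

lemma smooth_on_bounded_linear:
  "bounded_linear L \<Longrightarrow> open S \<Longrightarrow> smooth_on f S \<Longrightarrow> smooth_on (\<lambda>x. L (f x)) S"
  by (simp add: smooth_on_def times_differentiable_on_bounded_linear)

lemma smooth_on_bounded_bilinear:
  "bounded_bilinear B \<Longrightarrow> open S \<Longrightarrow> smooth_on f S \<Longrightarrow> smooth_on g S \<Longrightarrow>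
    smooth_on (\<lambda>x. B (f x) (g x)) S"
  by (simp add: smooth_on_def times_differentiable_on_bounded_bilinear)

lemma smooth_on_add:
  "open S \<Longrightarrow> smooth_on f S \<Longrightarrow> smooth_on g S \<Longrightarrow> smooth_on (\<lambda>x. f x + g x) S"
  by (simp add: smooth_on_def times_differentiable_on_add)

lemma smooth_on_diff:
  "open S \<Longrightarrow> smooth_on f S \<Longrightarrow> smooth_on g S \<Longrightarrow> smooth_on (\<lambda>x. f x - g x) S"
  using smooth_on_add[of S f "\<lambda>x. - g x"]
    smooth_on_bounded_linear[OF bounded_linear_minus[OF bounded_linear_ident], of S g] by simp

lemma smooth_on_sum:
  "open S \<Longrightarrow> (\<And>i. i \<in> I \<Longrightarrow> smooth_on (f i) S) \<Longrightarrow> smooth_on (\<lambda>x. \<Sum>i\<in>I. f i x) S"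
  by (simp add: smooth_on_def times_differentiable_on_sum)

lemma smooth_on_inverse:
  fixes f :: "'a::real_normed_vector \<Rightarrow> real"
  shows "open S \<Longrightarrow> (\<And>x. x \<in> S \<Longrightarrow> f x \<noteq> 0) \<Longrightarrow> smooth_on f S \<Longrightarrow> smooth_on (\<lambda>x. inverse (f x)) S"
  by (simp add: smooth_on_def times_differentiable_on_inverse)

lemma smooth_on_compose:
  fixes f :: "'a::real_normed_vector \<Rightarrow> 'c::euclidean_space"
  shows "open S \<Longrightarrow> f ` S \<subseteq> T \<Longrightarrow> smooth_on f S \<Longrightarrow> smooth_on h T \<Longrightarrow> smooth_on (\<lambda>x. h (f x)) S"
  by (simp add: smooth_on_def times_differentiable_on_compose)

lemma dird_bounded_linear:
  "bounded_linear L \<Longrightarrow> f differentiable (at x) \<Longrightarrow> dird v (\<lambda>x. L (f x)) x = L (dird v f x)"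
  by (rule dird_eqI[OF bounded_linear.has_derivative[OF _ has_derivative_dird]])

lemma dird_bounded_bilinear:
  "bounded_bilinear B \<Longrightarrow> f differentiable (at x) \<Longrightarrow> g differentiable (at x) \<Longrightarrow>
    dird v (\<lambda>x. B (f x) (g x)) x = B (f x) (dird v g x) + B (dird v f x) (g x)"
  by (rule dird_eqI[OF bounded_bilinear.FDERIV[OF _ has_derivative_dird has_derivative_dird]])

lemma dird_add:
  "f differentiable (at x) \<Longrightarrow> g differentiable (at x) \<Longrightarrow>
    dird v (\<lambda>x. f x + g x) x = dird v f x + dird v g x"
  by (rule dird_eqI) (intro has_derivative_add has_derivative_dird)

lemma dird_diff:
  "f differentiable (at x) \<Longrightarrow> g differentiable (at x) \<Longrightarrow>
    dird v (\<lambda>x. f x - g x) x = dird v f x - dird v g x"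
  by (rule dird_eqI) (intro has_derivative_diff has_derivative_dird)

section \<open>Symmetry of second derivatives by second differences\<close>

lemma second_difference:
  fixes f :: "'a::real_normed_vector \<Rightarrow> real"
  assumes "\<And>y. y \<in> S \<Longrightarrow> f differentiable (at y)"
    "\<And>y. y \<in> S \<Longrightarrow> dird v f differentiable (at y)"
    and "h > 0" "\<And>s t. 0 \<le> s \<Longrightarrow> s \<le> h \<Longrightarrow> 0 \<le> t \<Longrightarrow> t \<le> h \<Longrightarrow> x + s *\<^sub>R v + t *\<^sub>R w \<in> S"
  obtains s t where "0 < s" "s < h" "0 < t" "t < h"
    "f (x + h *\<^sub>R v + h *\<^sub>R w) - f (x + h *\<^sub>R v) - f (x + h *\<^sub>R w) + f x
      = h * h * dird w (dird v f) (x + s *\<^sub>R v + t *\<^sub>R w)"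
proof -
  have line: "((\<lambda>s. k (a + s *\<^sub>R u)) has_real_derivative dird u k (a + s *\<^sub>R u)) (at s)"
    if "k differentiable (at (a + s *\<^sub>R u))" for k :: "'a \<Rightarrow> real" and a u s
  proof -
    have "((\<lambda>s. a + s *\<^sub>R u) has_derivative (\<lambda>r. r *\<^sub>R u)) (at s)"
      by (auto intro!: derivative_eq_intros)
    from diff_chain_at[OF this has_derivative_dird[OF that]]
    have "((\<lambda>s. k (a + s *\<^sub>R u)) has_derivative (\<lambda>r. dird (r *\<^sub>R u) k (a + s *\<^sub>R u))) (at s)"
      by (simp add: o_def)
    moreover have "dird (r *\<^sub>R u) k (a + s *\<^sub>R u) = dird u k (a + s *\<^sub>R u) * r" for r
      using linear_cmul[OF has_derivative_linear[OF has_derivative_dird[OF that]]] by simp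
    ultimately show ?thesis
      by (simp add: has_field_derivative_def)
  qed
  \<comment> \<open>The mean value theorem is applied to the difference of \<open>f\<close> along
    two parallel segments in direction \<open>v\<close>, and afterwards in direction
    \<open>w\<close> to the derivative so obtained.\<close>
  have "((\<lambda>s. f ((x + h *\<^sub>R w) + s *\<^sub>R v) - f (x + s *\<^sub>R v)) has_real_derivative
      dird v f ((x + h *\<^sub>R w) + s *\<^sub>R v) - dird v f (x + s *\<^sub>R v)) (at s)"
    if "0 \<le> s" "s \<le> h" for s
    using assms(4)[of s h] assms(4)[of s 0] that assms(1,3)
    by (intro derivative_intros line) (auto simp: algebra_simps)
  from MVT2[OF assms(3) this] obtain s where s: "0 < s" "s < h"
    "(f ((x + h *\<^sub>R w) + h *\<^sub>R v) - f (x + h *\<^sub>R v)) - (f (x + h *\<^sub>R w) - f x) =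
      h * (dird v f ((x + h *\<^sub>R w) + s *\<^sub>R v) - dird v f (x + s *\<^sub>R v))"
    by auto
  have "((\<lambda>t. dird v f ((x + s *\<^sub>R v) + t *\<^sub>R w)) has_real_derivative
      dird w (dird v f) ((x + s *\<^sub>R v) + t *\<^sub>R w)) (at t)"
    if "0 \<le> t" "t \<le> h" for t
    using assms(4)[of s t] s that assms(2) by (intro line) auto
  from MVT2[OF assms(3) this] obtain t where t: "0 < t" "t < h"
    "dird v f (x + s *\<^sub>R v + h *\<^sub>R w) - dird v f (x + s *\<^sub>R v) =
      h * dird w (dird v f) (x + s *\<^sub>R v + t *\<^sub>R w)"
    by auto
  show ?thesis
    using s t by (intro that[of s t]) (auto simp: algebra_simps)
qed

text \<open>The second difference is symmetric in \<open>v\<close> and \<open>w\<close>, so both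
  mixed derivatives take a common value at points arbitrarily near \<open>x\<close>. By continuity
  their values at \<open>x\<close> cannot differ.\<close>

lemma dird_commute_real:
  fixes f :: "'a::real_normed_vector \<Rightarrow> real"
  assumes "open S" "smooth_on f S" "x \<in> S"
  shows "dird w (dird v f) x = dird v (dird w f) x"
proof (rule ccontr)
  assume ne: "dird w (dird v f) x \<noteq> dird v (dird w f) x"
  define e where "e = \<bar>dird w (dird v f) x - dird v (dird w f) x\<bar> / 2"
  have e: "e > 0"
    using ne by (simp add: e_def)
  have "isCont (dird w (dird v f)) x" "isCont (dird v (dird w f)) x"
    using assms smooth_on_dird smooth_on_continuous_on continuous_on_eq_continuous_at by blast+
  then obtain d1 d2 where d1: "d1 > 0" "\<And>y. dist y x < d1 \<Longrightarrow> dist (dird w (dird v f) y) (dird w (dird v f) x) < e"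
    and d2: "d2 > 0" "\<And>y. dist y x < d2 \<Longrightarrow> dist (dird v (dird w f) y) (dird v (dird w f) x) < e"
    using e by (metis continuous_at_eps_delta)
  obtain d3 where d3: "d3 > 0" "ball x d3 \<subseteq> S"
    using assms openE by blast
  define d where "d = min d1 (min d2 d3)"
  \<comment> \<open>This scale keeps the whole parallelogram strictly inside the ball of radius
    \<open>d\<close>; the summand 1 covers \<open>v = w = 0\<close> and makes the estimate
    strict.\<close>
  define h where "h = d / (1 + norm v + norm w)"
  have N: "1 + norm v + norm w > 0"
    by (smt (verit) norm_ge_zero)
  have d: "d > 0" and h: "h > 0"
    using d1 d2 d3 N by (auto simp: d_def h_def)
  have near: "dist (x + s *\<^sub>R v + t *\<^sub>R w) x < d" if "0 \<le> s" "s \<le> h" "0 \<le> t" "t \<le> h" for s t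
  proof -
    have "dist (x + s *\<^sub>R v + t *\<^sub>R w) x = norm (s *\<^sub>R v + t *\<^sub>R w)"
      by (simp add: dist_norm algebra_simps)
    also have "\<dots> \<le> s * norm v + t * norm w"
      using that norm_triangle_ineq[of "s *\<^sub>R v" "t *\<^sub>R w"] by simp
    also have "\<dots> \<le> h * norm v + h * norm w"
      using that by (intro add_mono mult_right_mono) auto
    also have "\<dots> < h * (1 + norm v + norm w)"
      using h by (simp add: algebra_simps)
    also have "\<dots> = d"
      using N by (simp add: h_def)
    finally show ?thesis .
  qed
  have inS: "x + s *\<^sub>R v + t *\<^sub>R w \<in> S" if "0 \<le> s" "s \<le> h" "0 \<le> t" "t \<le> h" for s t
    using near[OF that] d3(2) by (auto simp: d_def dist_commute)
  have dS: "k differentiable (at y)" if "k = f \<or> k = dird v f \<or> k = dird w f" "y \<in> S" for k y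
    using that assms smooth_on_dird smooth_on_differentiable by metis
  obtain s t where st: "0 < s" "s < h" "0 < t" "t < h"
    "f (x + h *\<^sub>R v + h *\<^sub>R w) - f (x + h *\<^sub>R v) - f (x + h *\<^sub>R w) + f x
      = h * h * dird w (dird v f) (x + s *\<^sub>R v + t *\<^sub>R w)"
    by (rule second_difference[of S f v h x w, OF _ _ h inS]) (simp_all add: dS)
  have inS': "x + s *\<^sub>R w + t *\<^sub>R v \<in> S" if "0 \<le> s" "s \<le> h" "0 \<le> t" "t \<le> h" for s t
    using inS[of t s] that by (simp add: algebra_simps)
  obtain s' t' where st': "0 < s'" "s' < h" "0 < t'" "t' < h"
    "f (x + h *\<^sub>R w + h *\<^sub>R v) - f (x + h *\<^sub>R w) - f (x + h *\<^sub>R v) + f x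
      = h * h * dird v (dird w f) (x + s' *\<^sub>R w + t' *\<^sub>R v)"
    by (rule second_difference[of S f w h x v, OF _ _ h inS']) (simp_all add: dS)
  have "h * h * dird w (dird v f) (x + s *\<^sub>R v + t *\<^sub>R w) =
      h * h * dird v (dird w f) (x + t' *\<^sub>R v + s' *\<^sub>R w)"
    using st(5) st'(5) by (simp add: algebra_simps)
  then have "dird w (dird v f) (x + s *\<^sub>R v + t *\<^sub>R w) = dird v (dird w f) (x + t' *\<^sub>R v + s' *\<^sub>R w)"
    using h by simp
  moreover have "dist (dird w (dird v f) (x + s *\<^sub>R v + t *\<^sub>R w)) (dird w (dird v f) x) < e"
    using near[of s t] st by (intro d1(2)) (auto simp: d_def)
  moreover have "dist (dird v (dird w f) (x + t' *\<^sub>R v + s' *\<^sub>R w)) (dird v (dird w f) x) < e"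
    using near[of t' s'] st' by (intro d2(2)) (auto simp: d_def)
  ultimately have "\<bar>dird w (dird v f) x - dird v (dird w f) x\<bar> < e + e"
    unfolding dist_real_def by linarith
  then show False
    by (simp add: e_def)
qed

lemma dird_commute:
  fixes f :: "'a::real_normed_vector \<Rightarrow> 'b::euclidean_space"
  assumes "open S" "smooth_on f S" "x \<in> S"
  shows "dird w (dird v f) x = dird v (dird w f) x"
proof (rule euclidean_eqI)
  fix b :: 'b
  have *: "dird w (dird v f) x \<bullet> b = dird w (dird v (\<lambda>x. f x \<bullet> b)) x" for v w
  proof -
    have 1: "dird v (\<lambda>x. f x \<bullet> b) y = dird v f y \<bullet> b" if "y \<in> S" for y
      using that assms by (intro dird_bounded_linear bounded_linear_inner_left smooth_on_differentiable)
    have 2: "dird w (\<lambda>x. dird v f x \<bullet> b) x = dird w (dird v f) x \<bullet> b"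
      using assms
      by (intro dird_bounded_linear bounded_linear_inner_left smooth_on_differentiable smooth_on_dird)
    show ?thesis
      using dird_cong_open[OF assms(1,3), of "dird v (\<lambda>x. f x \<bullet> b)" "\<lambda>x. dird v f x \<bullet> b" w] 1 2
      by simp
  qed
  show "dird w (dird v f) x \<bullet> b = dird v (dird w f) x \<bullet> b"
    unfolding * using assms smooth_on_bounded_linear[OF bounded_linear_inner_left]
    by (intro dird_commute_real) auto
qed

section \<open>Linear algebra\<close>

text \<open>The matrix of the tensor product of a vector \<open>u\<close> with a covector
  \<open>v\<close>, both given by component columns.\<close>

definition outer :: "real^'m \<Rightarrow> real^'n \<Rightarrow> real^'n^'m" where
  "outer u v = (\<chi> i j. u $ i * v $ j)"

lemma bounded_bilinear_outer: "bounded_bilinear (outer :: real^'m::finite \<Rightarrow> real^'n::finite \<Rightarrow> _)"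
  unfolding bilinear_conv_bounded_bilinear[symmetric] bilinear_def
  by (auto intro!: linearI simp: outer_def vec_eq_iff algebra_simps)

lemma bounded_bilinear_matrix_mul:
  "bounded_bilinear ((**) :: real^'n^'m::finite \<Rightarrow> real^'k::finite^'n::finite \<Rightarrow> _)"
  unfolding bilinear_conv_bounded_bilinear[symmetric] bilinear_def
  by (auto intro!: linearI simp: matrix_matrix_mult_def vec_eq_iff algebra_simps sum.distrib sum_distrib_left)

lemma bounded_bilinear_matrix_vector_mul:
  "bounded_bilinear ((*v) :: real^'n::finite^'m::finite \<Rightarrow> _)"
  unfolding bilinear_conv_bounded_bilinear[symmetric] bilinear_def
  by (auto intro!: linearI simp: matrix_vector_mult_def vec_eq_iff algebra_simps sum.distrib sum_distrib_left)

lemma outer_mult_vec: "outer u v *v w = (v \<bullet> w) *\<^sub>R u"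
  by (simp add: outer_def matrix_vector_mult_def inner_vec_def vec_eq_iff sum_distrib_left mult_ac)

lemma mat_mult_outer: "M ** outer u v = outer (M *v u) v"
  by (simp add: outer_def matrix_matrix_mult_def matrix_vector_mult_def vec_eq_iff sum_distrib_left mult_ac)

lemma outer_mult_mat: "outer u v ** M = outer u (transpose M *v v)"
  by (simp add: outer_def matrix_matrix_mult_def matrix_vector_mult_def transpose_def vec_eq_iff
      sum_distrib_left mult_ac del: transpose_matrix_vector)

lemma outer_mult_outer: "outer u v ** outer w z = (v \<bullet> w) *\<^sub>R outer u z"
  by (simp add: outer_def matrix_matrix_mult_def inner_vec_def vec_eq_iff sum_distrib_left mult_ac)

lemma transpose_outer: "transpose (outer u v) = outer v u"
  by (simp add: outer_def transpose_def vec_eq_iff)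

text \<open>Bases of the two eigenspaces together form a basis, in which \<open>J\<close> is
  diagonal with \<open>k\<close> entries 1 and \<open>k\<close> entries -1; the trace is invariant
  under conjugation.\<close>

lemma trace_involution_zero:
  fixes J :: "real^'n^'n"
  assumes JJ: "J ** J = mat 1"
    and d: "dim {v. J *v v = v} = k" "dim {v. J *v v = - v} = k" "2 * k = CARD('n)"
  shows "trace J = 0"
proof -
  obtain B1 where B1: "B1 \<subseteq> {v. J *v v = v}" "independent B1" "{v. J *v v = v} \<subseteq> span B1" "card B1 = k"
    by (rule basis_exists[of "{v. J *v v = v}", unfolded d(1)])
  obtain B2 where B2: "B2 \<subseteq> {v. J *v v = - v}" "independent B2" "{v. J *v v = - v} \<subseteq> span B2" "card B2 = k"
    by (rule basis_exists[of "{v. J *v v = - v}", unfolded d(2)])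
  have fin: "finite B1" "finite B2"
    using B1(2) B2(2) independent_imp_finite by auto
  have disj: "B1 \<inter> B2 = {}"
  proof (rule ccontr)
    assume "B1 \<inter> B2 \<noteq> {}"
    then obtain v where v: "v \<in> B1" "v \<in> B2" by auto
    then have "J *v v = v" "J *v v = - v" using B1(1) B2(1) by blast+
    then have "v + v = 0" by simp
    then have "v = 0" by (simp flip: scaleR_2)
    then show False using v(1) B1(2) dependent_zero by auto
  qed
  have span: "span (B1 \<union> B2) = UNIV"
  proof -
    have "v \<in> span (B1 \<union> B2)" for v
    proof -
      have JJv: "J *v (J *v v) = v"
        by (simp add: matrix_vector_mul_assoc JJ)
      \<comment> \<open>The two summands are the projections of \<open>v\<close> to the eigenspaces,
        which are complementary because \<open>J\<close> is an involution.\<close>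
      have "(1/2) *\<^sub>R (v + J *v v) \<in> span B1" "(1/2) *\<^sub>R (v - J *v v) \<in> span B2"
        using B1(3) B2(3) JJv
        by (auto simp: subset_iff algebra_simps)
      then have "(1/2) *\<^sub>R (v + J *v v) + (1/2) *\<^sub>R (v - J *v v) \<in> span (B1 \<union> B2)"
        by (meson span_add span_mono subsetD sup_ge1 sup_ge2)
      then show ?thesis
        by (simp add: scaleR_right_distrib scaleR_right_diff_distrib flip: scaleR_left_distrib)
    qed
    then show ?thesis by auto
  qed
  have "card (B1 \<union> B2) = CARD('n)"
    using card_Un_disjoint[OF fin disj] B1(4) B2(4) d(3) by simp
  then obtain b :: "'n \<Rightarrow> real^'n" where b: "bij_betw b UNIV (B1 \<union> B2)"
    using finite_same_card_bij[of "UNIV :: 'n set" "B1 \<union> B2"] fin by auto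
  define P :: "real^'n^'n" where "P = (\<chi> i j. b j $ i)"
  have col: "column j P = b j" for j
    by (simp add: P_def column_def)
  have "columns P = B1 \<union> B2"
    using b by (auto simp: columns_def col bij_betw_def image_def)
  then obtain Q where PQ: "P ** Q = mat 1"
    using span matrix_right_invertible_span_columns[of P] by (auto simp: span_vec_eq)
  then have QP: "Q ** P = mat 1"
    using matrix_left_right_inverse by blast
  define s where "s j = (if b j \<in> B1 then 1 else - 1 :: real)" for j
  have Jb: "J *v b j = s j *\<^sub>R b j" for j
    using b B1(1) B2(1) by (auto simp: s_def bij_betw_def)
  have "J ** P = P ** diagonal s"
  proof -
    have "(J ** P) $ i $ j = (P ** diagonal s) $ i $ j" for i j
    proof -
      have "(J ** P) $ i $ j = (J *v b j) $ i"
        by (simp add: matrix_matrix_mult_def matrix_vector_mult_def P_def)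
      also have "\<dots> = (P ** diagonal s) $ i $ j"
        by (simp add: Jb matrix_matrix_mult_def diagonal_def P_def if_distrib cong: if_cong)
      finally show ?thesis .
    qed
    then show ?thesis by (simp add: vec_eq_iff)
  qed
  then have "trace J = trace (P ** diagonal s ** Q)"
    by (metis PQ matrix_mul_assoc matrix_mul_rid)
  also have "\<dots> = trace (diagonal s)"
    by (metis QP matrix_mul_assoc matrix_mul_lid trace_mul_sym)
  also have "\<dots> = (\<Sum>j\<in>UNIV. s j)"
    by (simp add: trace_def diagonal_def)
  also have "\<dots> = (\<Sum>v\<in>B1 \<union> B2. if v \<in> B1 then 1 else - 1)"
    unfolding s_def using sum.reindex_bij_betw[OF b, of "\<lambda>v. if v \<in> B1 then 1 else - 1 :: real"] by simp
  also have "\<dots> = (\<Sum>v\<in>B1. 1) + (\<Sum>v\<in>B2. - 1)"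
  proof -
    have "(\<Sum>v\<in>B2. if v \<in> B1 then 1 else - 1 :: real) = (\<Sum>v\<in>B2. - 1)"
      using disj by (intro sum.cong) auto
    then show ?thesis
      by (simp add: sum.union_disjoint[OF fin disj])
  qed
  also have "\<dots> = 0"
    using B1(4) B2(4) by simp
  finally show ?thesis .
qed

lemma inner_matrix_vector_transpose: "(M *v u) \<bullet> v = u \<bullet> (transpose M *v (v :: real^'n))"
  for M :: "real^'m::finite^'n::finite"
  by (metis dot_lmul_matrix inner_commute transpose_matrix_vector)

text \<open>Pointwise algebra, free of derivatives. \<open>h\<close> is the inverse of the metric
  \<open>g\<close>, and the shape of \<open>R\<close> is unchanged when \<open>g\<close> is scaled
  and \<open>h\<close> inversely, so any representative of the conformal class may be inserted. The
  bound on the dimension comes from \<open>e = - 1\<close>, where the final coefficient is 2n -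
  4.\<close>

lemma ricci_trace_vanishes:
  fixes J g h :: "real^'n^'n" and p :: "'n \<Rightarrow> real^'n" and R :: "'n \<Rightarrow> 'n \<Rightarrow> real^'n^'n"
  assumes n: "CARD('n) > 2"
    and hg: "h ** g = mat 1" and gsym: "transpose g = g"
    and JJ: "J ** J = mat 1" and trJ: "trace J = 0"
    and JgJ: "transpose J ** g ** J = e *\<^sub>R g" and e: "e = 1 \<or> e = - 1"
    and R: "\<And>i j. R i j = outer (axis j 1) (p i) - outer (axis i 1) (p j)
        - outer (h *v p i) (g *v axis j 1) + outer (h *v p j) (g *v axis i 1)"
    and comm: "\<And>i j. J ** R i j = R i j ** J"
  shows "(\<Sum>j\<in>UNIV. \<Sum>k\<in>UNIV. h $ j $ k * (\<Sum>i\<in>UNIV. R i j $ i $ k)) = 0"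
proof -
  note [simp del] = transpose_matrix_vector
  have gh: "g ** h = mat 1"
    using hg matrix_left_right_inverse by blast
  have hsym: "transpose h = h"
    by (metis gh gsym hg matrix_mul_assoc matrix_mul_lid matrix_mul_rid matrix_transpose_mul transpose_mat)
  \<comment> \<open>The condition on \<open>J\<close> is carried to the inverse metric; terms of
    \<open>R\<close> whose index is raised need this dual form.\<close>
  have JhJ: "J ** h ** transpose J = e *\<^sub>R h"
  proof -
    have ee: "e * e = 1" using e by auto
    have "transpose J ** g = e *\<^sub>R (g ** J)"
      using JgJ JJ by (metis matrix_mul_assoc matrix_mul_rid scalar_matrix_assoc scaleR_matrix_vector_assoc)
    then have "h ** (transpose J ** g) ** h = h ** (e *\<^sub>R (g ** J)) ** h"
      by simp
    then have "h ** transpose J = e *\<^sub>R (J ** h)"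
      by (metis gh hg matrix_mul_assoc matrix_mul_lid matrix_mul_rid matrix_scalar_ac scalar_matrix_assoc)
    then have "J ** (h ** transpose J) = e *\<^sub>R (J ** J ** h)"
      by (simp add: matrix_scalar_ac scalar_matrix_assoc matrix_mul_assoc)
    then show ?thesis
      by (simp add: JJ matrix_mul_assoc)
  qed
  define \<tau> where "\<tau> = (\<Sum>i\<in>UNIV. (h *v p i) $ i)"
  define w where "w j = h *v axis j 1" for j
  \<comment> \<open>\<open>\<Phi>\<close> is the contraction that yields the scalar curvature:
    \<open>w j\<close> raises an index by \<open>h\<close>, and \<open>i\<close> is traced against
    the upper index of the matrix. It is evaluated twice, on \<open>R\<close> and on
    \<open>J ** R ** J\<close>.\<close>
  define \<Phi> where "\<Phi> M = (\<Sum>i\<in>UNIV. \<Sum>j\<in>UNIV. (M i j *v w j) $ i)" for M :: "'n \<Rightarrow> 'n \<Rightarrow> real^'n^'n"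
  have h_comp: "w j $ k = h $ j $ k" for j k
    using arg_cong[OF hsym, of "\<lambda>B. B $ j $ k"]
    by (simp add: w_def matrix_vector_mult_basis column_def transpose_def)
  have S: "(\<Sum>j\<in>UNIV. \<Sum>k\<in>UNIV. h $ j $ k * (\<Sum>i\<in>UNIV. R i j $ i $ k)) = \<Phi> R"
  proof -
    have "(\<Sum>k\<in>UNIV. h $ j $ k * (\<Sum>i\<in>UNIV. R i j $ i $ k)) = (\<Sum>i\<in>UNIV. (R i j *v w j) $ i)" for j
      unfolding sum_distrib_left
      by (subst sum.swap) (simp add: matrix_vector_mult_def h_comp mult_ac)
    then show ?thesis
      unfolding \<Phi>_def by (subst sum.swap) simp
  qed
  have pw: "u \<bullet> w j = (h *v u) $ j" for u j
    by (simp add: w_def inner_matrix_vector_transpose[of h, unfolded hsym] inner_commute[of u] inner_axis' hsym)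
  have gw: "(g *v u) \<bullet> w j = u $ j" for u j
    by (simp add: pw matrix_vector_mul_assoc hg)
  have ax: "axis i (1::real) $ j = (if j = i then 1 else 0)" for i j :: 'n
    by (simp add: axis_def)
  have "\<Phi> R = \<tau> - CARD('n) * \<tau> - CARD('n) * \<tau> + \<tau>"
  proof -
    \<comment> \<open>The first and last summands collapse to the diagonal and give \<tau> once;
      each of the two middle ones leaves one index free and is counted once per dimension.\<close>
    have entry: "(R i j *v w j) $ i = (if j = i then (h *v p i) $ j else 0) - (h *v p j) $ j - (h *v p i) $ i
        + (if j = i then (h *v p j) $ i else 0)" for i j
      unfolding R
      by (simp add: matrix_vector_mult_add_rdistrib matrix_vector_mult_diff_rdistrib outer_mult_vec
          pw[of "p i"] pw[of "p j"] gw ax)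
    then show ?thesis
      unfolding \<Phi>_def entry by (simp add: sum.distrib sum_subtractf \<tau>_def flip: sum_distrib_left)
  qed
  moreover have "\<Phi> R = e * \<tau> + e * \<tau>"
  proof -
    have "R i j = J ** R i j ** J" for i j
      using comm[of i j] JJ by (metis matrix_mul_assoc matrix_mul_rid)
    then have "\<Phi> R = \<Phi> (\<lambda>i j. J ** R i j ** J)"
      by simp
    \<comment> \<open>In the first sum \<open>J\<close> surrounds \<open>h\<close> and in the last
      it surrounds \<open>g\<close>, which returns \<open>e\<close> times the uncontracted tensor.
      In the two middle sums \<open>i\<close> and \<open>j\<close> decouple, and a factor equal to
      the trace of \<open>J\<close> splits off.\<close>
    also have "\<dots> = (\<Sum>i\<in>UNIV. \<Sum>j\<in>UNIV. (p i \<bullet> (J *v w j)) * J $ i $ j)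
        - (\<Sum>i\<in>UNIV. \<Sum>j\<in>UNIV. (p j \<bullet> (J *v w j)) * J $ i $ i)
        - (\<Sum>i\<in>UNIV. \<Sum>j\<in>UNIV. ((g *v axis j 1) \<bullet> (J *v w j)) * (J *v (h *v p i)) $ i)
        + (\<Sum>i\<in>UNIV. \<Sum>j\<in>UNIV. ((g *v axis i 1) \<bullet> (J *v w j)) * (J *v (h *v p j)) $ i)"
    proof -
      have "(J ** R i j ** J) *v w j = (p i \<bullet> (J *v w j)) *\<^sub>R (J *v axis j 1)
          - (p j \<bullet> (J *v w j)) *\<^sub>R (J *v axis i 1)
          - ((g *v axis j 1) \<bullet> (J *v w j)) *\<^sub>R (J *v (h *v p i))
          + ((g *v axis i 1) \<bullet> (J *v w j)) *\<^sub>R (J *v (h *v p j))" for i j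
        unfolding matrix_vector_mul_assoc[symmetric] R
        by (simp add: matrix_vector_mult_add_rdistrib matrix_vector_mult_diff_rdistrib outer_mult_vec
            matrix_vector_right_distrib matrix_vector_mult_diff_distrib matrix_vector_mult_scaleR)
      then show ?thesis
        by (simp add: \<Phi>_def sum.distrib sum_subtractf matrix_vector_mult_basis column_def)
    qed
    also have "(\<Sum>i\<in>UNIV. \<Sum>j\<in>UNIV. (p i \<bullet> (J *v w j)) * J $ i $ j) = e * \<tau>"
    proof -
      have "p i \<bullet> (J *v w j) = (h *v (transpose J *v p i)) $ j" for i j
        by (metis inner_commute inner_matrix_vector_transpose pw)
      then have "(\<Sum>j\<in>UNIV. (p i \<bullet> (J *v w j)) * J $ i $ j) = (J *v (h *v (transpose J *v p i))) $ i" for i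
        by (simp add: matrix_vector_mult_def[of J] mult_ac)
      also have "\<And>i. (J *v (h *v (transpose J *v p i))) $ i = e * (h *v p i) $ i"
        by (simp add: matrix_vector_mul_assoc matrix_mul_assoc JhJ flip: scaleR_matrix_vector_assoc)
      finally show ?thesis
        by (simp add: \<tau>_def sum_distrib_left)
    qed
    also have "(\<Sum>i\<in>UNIV. \<Sum>j\<in>UNIV. (p j \<bullet> (J *v w j)) * J $ i $ i) = 0"
      using trJ by (simp add: trace_def flip: sum_distrib_right sum_distrib_left)
    also have "(\<Sum>i\<in>UNIV. \<Sum>j\<in>UNIV. ((g *v axis j 1) \<bullet> (J *v w j)) * (J *v (h *v p i)) $ i) = 0"
    proof -
      have "(g *v axis j 1) \<bullet> (J *v w j) = ((g ** J ** h) *v axis j 1) $ j" for j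
        by (simp add: inner_matrix_vector_transpose gsym inner_axis' w_def matrix_vector_mul_assoc
            matrix_mul_assoc)
      then have "(g *v axis j 1) \<bullet> (J *v w j) = (g ** J ** h) $ j $ j" for j
        by (simp add: matrix_vector_mult_basis column_def)
      then have "(\<Sum>j\<in>UNIV. (g *v axis j 1) \<bullet> (J *v w j)) = trace (g ** J ** h)"
        by (simp add: trace_def)
      \<comment> \<open>Cyclicity of the trace brings \<open>h\<close> next to
        \<open>g\<close>.\<close>
      also have "\<dots> = trace J"
        by (metis hg matrix_mul_assoc matrix_mul_lid trace_mul_sym)
      finally show ?thesis
        using trJ by (simp flip: sum_distrib_right)
    qed
    also have "(\<Sum>i\<in>UNIV. \<Sum>j\<in>UNIV. ((g *v axis i 1) \<bullet> (J *v w j)) * (J *v (h *v p j)) $ i) = e * \<tau>"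
    proof -
      have "(g *v axis i 1) \<bullet> u = (g *v u) $ i" for i u
        by (simp add: inner_matrix_vector_transpose gsym inner_axis')
      then have "(\<Sum>i\<in>UNIV. ((g *v axis i 1) \<bullet> (J *v w j)) * (J *v (h *v p j)) $ i) =
          (J *v (h *v p j)) \<bullet> (g *v (J *v w j))" for j
        by (simp add: inner_vec_def mult_ac)
      also have "\<And>j. (J *v (h *v p j)) \<bullet> (g *v (J *v w j)) = (h *v p j) \<bullet> ((transpose J ** g ** J) *v w j)"
        by (simp add: inner_matrix_vector_transpose matrix_vector_mul_assoc matrix_mul_assoc matrix_transpose_mul)
      also have "\<And>j. (h *v p j) \<bullet> ((transpose J ** g ** J) *v w j) = e * (h *v p j) $ j"
        unfolding JgJ
        by (simp add: w_def matrix_vector_mul_assoc gh inner_axis flip: scalar_matrix_assoc scaleR_matrix_vector_assoc)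
      finally show ?thesis
        by (subst sum.swap) (simp add: \<tau>_def sum_distrib_left)
    qed
    finally show ?thesis by simp
  qed
  ultimately have "(2 * real CARD('n) - 2 + 2 * e) * \<tau> = 0" and "\<Phi> R = 2 * e * \<tau>"
    by (auto simp: algebra_simps)
  moreover have "2 * real CARD('n) - 2 + 2 * e \<noteq> 0"
    using n e by auto
  ultimately show ?thesis
    unfolding S by simp
qed

lemmas matrix_mul_bilinear =
  bounded_bilinear.add_left[OF bounded_bilinear_matrix_mul]
  bounded_bilinear.add_right[OF bounded_bilinear_matrix_mul]
  bounded_bilinear.diff_left[OF bounded_bilinear_matrix_mul]
  bounded_bilinear.diff_right[OF bounded_bilinear_matrix_mul]
  bounded_bilinear.scaleR_left[OF bounded_bilinear_matrix_mul]
  bounded_bilinear.scaleR_right[OF bounded_bilinear_matrix_mul]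

lemmas outer_bilinear =
  bounded_bilinear.add_left[OF bounded_bilinear_outer]
  bounded_bilinear.add_right[OF bounded_bilinear_outer]
  bounded_bilinear.diff_left[OF bounded_bilinear_outer]
  bounded_bilinear.diff_right[OF bounded_bilinear_outer]
  bounded_bilinear.scaleR_left[OF bounded_bilinear_outer]
  bounded_bilinear.scaleR_right[OF bounded_bilinear_outer]

section \<open>Conformally flat metrics in an arbitrary chart\<close>

lemma bounded_linear_component2: "bounded_linear (\<lambda>M :: real^'n^'m. M $ i $ k)"
  using bounded_linear_compose[OF bounded_linear_vec_nth bounded_linear_vec_nth] .

lemma bounded_linear_transpose: "bounded_linear (transpose :: real^'n^'m \<Rightarrow> _)"
  unfolding linear_conv_bounded_linear[symmetric]
  by (auto intro!: linearI simp: transpose_def vec_eq_iff)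

lemma partial_component:
  "f differentiable (at x) \<Longrightarrow> partial m (\<lambda>y. f y $ i $ k) x = dird (axis m 1) f x $ i $ k"
  by (simp add: partial_eq_dird dird_bounded_linear[OF bounded_linear_component2])

lemma matrix_inv_eqI:
  fixes M :: "real^'n^'n"
  assumes "H ** M = mat 1"
  shows "matrix_inv M = H"
proof -
  have MH: "M ** H = mat 1"
    using assms matrix_left_right_inverse by blast
  have "M ** matrix_inv M = mat 1 \<and> matrix_inv M ** M = mat 1"
    unfolding matrix_inv_def by (rule someI[where x = H]) (simp add: assms MH)
  then show ?thesis
    by (metis assms matrix_mul_assoc matrix_mul_lid matrix_mul_rid)
qed

text \<open>Uniqueness of the Levi-Civita connection at a single point: a torsion-free and metric
  candidate \<open>L\<close> must be given by the Christoffel symbols. A connection found by insight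
  can thus be verified instead of computed from the inverse metric.\<close>

lemma christoffel_eqI:
  fixes G :: "real^'n \<Rightarrow> real^'n^'n" and L :: "'n \<Rightarrow> real^'n^'n"
  assumes diff: "G differentiable (at x)" and inv: "H ** G x = mat 1"
    and sym: "transpose (G x) = G x"
    and torsion: "\<And>i k l. L i $ l $ k = L k $ l $ i"
    and metric: "\<And>m. dird (axis m 1) G x = transpose (L m) ** G x + G x ** L m"
  shows "christoffel G l i k x = L i $ l $ k"
proof -
  have dG: "dird (axis i 1) G x $ k $ m = (G x ** L i) $ m $ k + (G x ** L i) $ k $ m" for i k m
  proof -
    have "transpose (L i) ** G x = transpose (G x ** L i)"
      by (simp add: matrix_transpose_mul sym)
    then show ?thesis
      by (simp add: metric transpose_def)
  qed
  have tors: "(G x ** L i) $ m $ k = (G x ** L k) $ m $ i" for i k m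
    by (simp add: matrix_matrix_mult_def torsion[of i _ k])
  \<comment> \<open>Koszul combination: metricity turns it into six entries of products of
    \<open>G x\<close> with \<open>L\<close>. By \<open>tors\<close> two pairs cancel and the
    remaining two entries agree.\<close>
  have "partial i (\<lambda>y. G y $ k $ m) x + partial k (\<lambda>y. G y $ i $ m) x - partial m (\<lambda>y. G y $ i $ k) x
      = 2 * (G x ** L i) $ m $ k" for m
    unfolding partial_component[OF diff] dG
    using tors[of i m k] tors[of i k m] tors[of k i m] by simp
  then have "christoffel G l i k x = (matrix_inv (G x) ** (G x ** L i)) $ l $ k"
    unfolding christoffel_def matrix_matrix_mult_def[of "matrix_inv (G x)"]
    by (simp add: sum_distrib_left)
  then show ?thesis
    by (simp add: matrix_mul_assoc matrix_inv_eqI[OF inv] inv)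
qed

lemma diagonal_signs_square:
  "(\<And>i. e i \<in> {1, -1}) \<Longrightarrow> diagonal e ** diagonal e = (mat 1 :: real^'n^'n)"
proof -
  assume e: "\<And>i. e i \<in> {1, -1}"
  have "e i * e i = 1" for i
    using e[of i] by auto
  moreover have "(\<Sum>k\<in>UNIV. diagonal e $ i $ k * diagonal e $ k $ j) =
      (\<Sum>k\<in>UNIV. if k = i then (if i = j then e i * e i else 0) else 0)" for i j
    by (intro sum.cong) (auto simp: diagonal_def)
  ultimately show ?thesis
    by (simp add: matrix_matrix_mult_def mat_def vec_eq_iff)
qed

lemma transpose_diagonal: "transpose (diagonal e) = diagonal e"
  by (auto simp: diagonal_def transpose_def vec_eq_iff)


text \<open>Only the Jacobian \<open>D\<close> of the flat coordinates enters. Condition \<open>closed_D\<close> says that its rows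
  are closed 1-forms. This avoids transforming the curvature tensor between charts.\<close>

locale conformal_frame =
  fixes S :: "(real^'n) set" and \<omega> :: "real^'n \<Rightarrow> real" and D W :: "real^'n \<Rightarrow> real^'n^'n"
    and e :: "'n \<Rightarrow> real" and G :: "real^'n \<Rightarrow> real^'n^'n"
  assumes open_S: "open S"
    and smooth_\<omega>: "smooth_on \<omega> S" and \<omega>_nz: "x \<in> S \<Longrightarrow> \<omega> x \<noteq> 0"
    and smooth_D: "smooth_on D S" and smooth_W: "smooth_on W S"
    and WD: "x \<in> S \<Longrightarrow> W x ** D x = mat 1"
    and closed_D: "x \<in> S \<Longrightarrow> dird (axis i 1) D x *v axis k 1 = dird (axis k 1) D x *v axis i 1"
    and signs: "e i \<in> {1, -1}"
    and G_eq: "x \<in> S \<Longrightarrow> G x = \<omega> x *\<^sub>R (transpose (D x) ** diagonal e ** D x)"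
begin

abbreviation pd :: "'n \<Rightarrow> (real^'n \<Rightarrow> 'b::real_normed_vector) \<Rightarrow> real^'n \<Rightarrow> 'b" where
  "pd i \<equiv> dird (axis i 1)"

abbreviation "E \<equiv> diagonal e"

text \<open>Components in the given chart of the differential of 1/2 log |\<omega>|, written without
  a logarithm so that the sign of \<omega> does not enter. \<open>\<phi>\<close> is the same
  covector in the flat coordinates.\<close>

definition "\<psi> i x = inverse (2 * \<omega> x) * pd i \<omega> x"

definition "\<phi> x = transpose (W x) *v (\<chi> i. \<psi> i x)"

text \<open>The coordinate fields of the given chart, expressed in the flat frame.\<close>

abbreviation "col i x \<equiv> D x *v axis i 1"

text \<open>\<open>A\<close> is the connection matrix in the frame of coordinate fields of the flat coordinates,
  in which \<open>\<phi>\<close> is the differential of $\frac12 \log |\omega|$. Passing to the given chart is the gauge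
  transformation \<open>\<Gamma>\<close>.\<close>

definition "A i x = \<psi> i x *\<^sub>R mat 1 + outer (col i x) (\<phi> x) - outer (E *v \<phi> x) (E *v col i x)"

definition "\<Gamma> i x = W x ** (A i x ** D x + pd i D x)"

section \<open>Smoothness of the connection data\<close>

lemma EE: "E ** E = mat 1"
  using diagonal_signs_square[of e] signs by blast

lemma EEv: "E *v (E *v v) = v"
  by (simp add: matrix_vector_mul_assoc EE)

lemma E_sym: "(E *v u) \<bullet> v = u \<bullet> (E *v v)"
  by (metis inner_matrix_vector_transpose transpose_diagonal)

lemma DW: "x \<in> S \<Longrightarrow> D x ** W x = mat 1"
  using WD matrix_left_right_inverse by blast

lemma smooth_\<psi>: "smooth_on (\<psi> i) S"
  unfolding \<psi>_def
  by (rule smooth_on_bounded_bilinear[OF bounded_bilinear_mult open_S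
        smooth_on_inverse[OF open_S _ smooth_on_bounded_linear[OF bounded_linear_mult_right open_S smooth_\<omega>]]
        smooth_on_dird[OF smooth_\<omega>]]) (simp add: \<omega>_nz)

lemma smooth_\<phi>: "smooth_on \<phi> S"
proof -
  have "(\<chi> i. \<psi> i x) = (\<Sum>i\<in>UNIV. \<psi> i x *\<^sub>R axis i 1)" for x
    by (simp add: vec_eq_iff axis_def if_distrib cong: if_cong)
  then have "smooth_on (\<lambda>x. \<chi> i. \<psi> i x) S"
    by (auto intro!: smooth_on_sum[OF open_S]
        smooth_on_bounded_bilinear[OF bounded_bilinear_scaleR open_S smooth_\<psi> smooth_on_const])
  then show ?thesis
    unfolding \<phi>_def
    by (intro smooth_on_bounded_bilinear[OF bounded_bilinear_matrix_vector_mul open_S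
          smooth_on_bounded_linear[OF bounded_linear_transpose open_S smooth_W]])
qed

lemma smooth_col: "smooth_on (\<lambda>x. D x *v v) S"
  by (rule smooth_on_bounded_bilinear[OF bounded_bilinear_matrix_vector_mul open_S smooth_D smooth_on_const])

lemma smooth_A: "smooth_on (A i) S"
proof -
  have E: "smooth_on (\<lambda>x. E *v f x) S" if "smooth_on f S" for f :: "real^'n \<Rightarrow> real^'n"
    using smooth_on_bounded_bilinear[OF bounded_bilinear_matrix_vector_mul open_S smooth_on_const that] .
  show ?thesis
    unfolding A_def
    by (rule smooth_on_diff[OF open_S smooth_on_add[OF open_S]]
       smooth_on_bounded_bilinear[OF bounded_bilinear_outer open_S]
       smooth_on_bounded_bilinear[OF bounded_bilinear_scaleR open_S]
       smooth_\<psi> smooth_\<phi> smooth_col smooth_on_const E)+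
qed

lemma smooth_\<Gamma>: "smooth_on (\<Gamma> i) S"
  unfolding \<Gamma>_def
  by (rule smooth_on_bounded_bilinear[OF bounded_bilinear_matrix_mul open_S] smooth_on_add[OF open_S]
      smooth_A smooth_D smooth_W smooth_on_dird)+

section \<open>Identification of the Levi-Civita connection\<close>

lemmas diff_D = smooth_on_differentiable[OF smooth_D]

lemma pd_col: "x \<in> S \<Longrightarrow> pd i (\<lambda>x. D x *v v) x = pd i D x *v v"
  using dird_bounded_linear[OF bounded_bilinear.bounded_linear_left[OF bounded_bilinear_matrix_vector_mul] diff_D]
  by blast

lemma \<phi>_col: "x \<in> S \<Longrightarrow> \<phi> x \<bullet> col i x = \<psi> i x"
  by (simp add: \<phi>_def inner_matrix_vector_transpose matrix_vector_mul_assoc WD inner_axis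
      del: transpose_matrix_vector)

lemma D_\<Gamma>: "x \<in> S \<Longrightarrow> D x ** \<Gamma> i x = A i x ** D x + pd i D x"
  by (simp add: \<Gamma>_def matrix_mul_assoc DW)

text \<open>Applied to a coordinate field, \<open>A\<close> yields an expression symmetric in both
  directions, since \<open>E\<close> is symmetric; the inhomogeneous gauge term is symmetric because
  the rows of \<open>D\<close> are closed.\<close>

lemma \<Gamma>_torsion_free:
  assumes x: "x \<in> S"
  shows "\<Gamma> i x $ l $ k = \<Gamma> k x $ l $ i"
proof -
  have "(A i x ** D x + pd i D x) *v axis k 1 = \<psi> i x *\<^sub>R col k x + \<psi> k x *\<^sub>R col i x
      - ((E *v col i x) \<bullet> col k x) *\<^sub>R (E *v \<phi> x) + pd i D x *v axis k 1" for i k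
    by (simp add: A_def matrix_vector_mult_add_rdistrib matrix_vector_mult_diff_rdistrib outer_mult_vec
        \<phi>_col[OF x] flip: matrix_vector_mul_assoc scaleR_matrix_vector_assoc)
  then have "(A i x ** D x + pd i D x) *v axis k 1 = (A k x ** D x + pd k D x) *v axis i 1"
    using closed_D[OF x, of i k] E_sym[of "col i x" "col k x"] by (simp add: inner_commute)
  then have "\<Gamma> i x *v axis k 1 = \<Gamma> k x *v axis i 1"
    by (simp add: \<Gamma>_def flip: matrix_vector_mul_assoc)
  then show ?thesis
    by (simp add: matrix_vector_mult_basis column_def vec_eq_iff)
qed

lemma smooth_G: "smooth_on G S"
proof -
  have "smooth_on (\<lambda>x. \<omega> x *\<^sub>R (transpose (D x) ** E ** D x)) S"
    by (rule smooth_on_bounded_bilinear[OF bounded_bilinear_matrix_mul open_S]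
        smooth_on_bounded_bilinear[OF bounded_bilinear_scaleR open_S]
        smooth_on_bounded_linear[OF bounded_linear_transpose open_S]
        smooth_\<omega> smooth_D smooth_on_const)+
  then show ?thesis
    using smooth_on_cong[OF open_S, of "\<lambda>x. \<omega> x *\<^sub>R (transpose (D x) ** E ** D x)" G] G_eq by auto
qed

lemma G_sym: "x \<in> S \<Longrightarrow> transpose (G x) = G x"
  by (simp add: G_eq transpose_scalar matrix_transpose_mul transpose_diagonal matrix_mul_assoc)

lemma pd_\<omega>: "x \<in> S \<Longrightarrow> pd i \<omega> x = 2 * \<omega> x * \<psi> i x"
  using \<omega>_nz by (simp add: \<psi>_def)

text \<open>The two outer products in \<open>A\<close> form a matrix that is skew for
  \<open>E\<close>. Only the multiple \<open>\<psi>\<close> of the identity survives symmetrisation,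
  and it accounts exactly for the derivative of the conformal factor.\<close>

lemma pd_G:
  assumes x: "x \<in> S"
  shows "pd m G x = transpose (\<Gamma> m x) ** G x + G x ** \<Gamma> m x"
proof -
  have d: "D differentiable (at x)" "(\<lambda>x. transpose (D x)) differentiable (at x)"
    "(\<lambda>x. transpose (D x) ** E) differentiable (at x)"
    "(\<lambda>x. transpose (D x) ** E ** D x) differentiable (at x)" "\<omega> differentiable (at x)"
    using x by (auto intro!: smooth_on_differentiable[of _ S] smooth_D smooth_\<omega>
        smooth_on_bounded_bilinear[OF bounded_bilinear_matrix_mul open_S]
        smooth_on_bounded_linear[OF bounded_linear_transpose open_S] smooth_on_const)
  have "pd m G x = pd m (\<lambda>x. \<omega> x *\<^sub>R (transpose (D x) ** E ** D x)) x"
    by (rule dird_cong_open[OF open_S x G_eq])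
  also have "\<dots> = \<omega> x *\<^sub>R (transpose (D x) ** E ** pd m D x + transpose (pd m D x) ** E ** D x)
      + pd m \<omega> x *\<^sub>R (transpose (D x) ** E ** D x)"
    using dird_bounded_bilinear[OF bounded_bilinear_scaleR d(5) d(4)]
      dird_bounded_bilinear[OF bounded_bilinear_matrix_mul d(3) d(1)]
      dird_bounded_linear[OF bounded_bilinear.bounded_linear_left[OF bounded_bilinear_matrix_mul, of E] d(2)]
      dird_bounded_linear[OF bounded_linear_transpose d(1)]
    by simp
  also have "\<dots> = transpose (\<Gamma> m x) ** G x + G x ** \<Gamma> m x"
  proof -
    have "E ** A m x = \<psi> m x *\<^sub>R E + outer (E *v col m x) (\<phi> x) - outer (\<phi> x) (E *v col m x)"
      by (simp add: A_def matrix_mul_bilinear mat_mult_outer EEv)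
    moreover from this have "transpose (E ** A m x) = \<psi> m x *\<^sub>R E + outer (\<phi> x) (E *v col m x) - outer (E *v col m x) (\<phi> x)"
      by (simp add: linear_diff[OF bounded_linear.linear[OF bounded_linear_transpose]]
          linear_add[OF bounded_linear.linear[OF bounded_linear_transpose]] transpose_scalar transpose_outer
          transpose_diagonal)
    moreover have "transpose (A m x) ** E = transpose (E ** A m x)"
      by (simp add: matrix_transpose_mul transpose_diagonal)
    ultimately have AE: "transpose (A m x) ** E + E ** A m x = (2 * \<psi> m x) *\<^sub>R E"
      by (simp, simp add: vec_eq_iff)
    have "G x ** \<Gamma> m x = \<omega> x *\<^sub>R (transpose (D x) ** (E ** A m x) ** D x + transpose (D x) ** E ** pd m D x)"
      by (simp add: G_eq[OF x] matrix_mul_bilinear D_\<Gamma>[OF x] flip: matrix_mul_assoc)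
    moreover have "transpose (\<Gamma> m x) ** G x = transpose (G x ** \<Gamma> m x)"
      by (simp add: matrix_transpose_mul G_sym[OF x])
    ultimately have "transpose (\<Gamma> m x) ** G x + G x ** \<Gamma> m x =
       \<omega> x *\<^sub>R (transpose (D x) ** (transpose (A m x) ** E + E ** A m x) ** D x
         + (transpose (D x) ** E ** pd m D x + transpose (pd m D x) ** E ** D x))"
      by (simp add: linear_add[OF bounded_linear.linear[OF bounded_linear_transpose]] transpose_scalar
          transpose_diagonal matrix_transpose_mul matrix_mul_bilinear matrix_mul_assoc scaleR_add_right)
    then show ?thesis
      unfolding AE by (simp add: matrix_mul_bilinear pd_\<omega>[OF x] scaleR_add_right mult_ac)
  qed
  finally show ?thesis .
qed

text \<open>The metric stripped of its conformal factor, and its inverse. Raising one index and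
  lowering another inside the curvature formula can be done with these, since the factor
  cancels.\<close>

definition "G\<^sub>0 x = transpose (D x) ** E ** D x"
definition "H\<^sub>0 x = W x ** E ** transpose (W x)"

lemma H\<^sub>0_G\<^sub>0:
  assumes x: "x \<in> S"
  shows "H\<^sub>0 x ** G\<^sub>0 x = mat 1"
proof -
  have t: "transpose (W x) ** transpose (D x) = mat 1"
    using DW[OF x] by (metis matrix_transpose_mul transpose_mat)
  have "H\<^sub>0 x ** G\<^sub>0 x = W x ** E ** (transpose (W x) ** transpose (D x)) ** E ** D x"
    by (simp add: H\<^sub>0_def G\<^sub>0_def matrix_mul_assoc)
  also have "\<dots> = W x ** (E ** E) ** D x"
    by (simp add: t flip: matrix_mul_assoc)
  finally show ?thesis
    by (simp add: EE WD[OF x])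
qed

lemma matrix_inv_G:
  assumes x: "x \<in> S"
  shows "matrix_inv (G x) = inverse (\<omega> x) *\<^sub>R H\<^sub>0 x"
proof (rule matrix_inv_eqI)
  show "(inverse (\<omega> x) *\<^sub>R H\<^sub>0 x) ** G x = mat 1"
    using H\<^sub>0_G\<^sub>0[OF x] \<omega>_nz[OF x] by (simp add: G_eq[OF x] matrix_mul_bilinear G\<^sub>0_def)
qed

lemma christoffel_G: "x \<in> S \<Longrightarrow> christoffel G l i k x = \<Gamma> i x $ l $ k"
  using H\<^sub>0_G\<^sub>0 \<omega>_nz
  by (intro christoffel_eqI[where H = "inverse (\<omega> x) *\<^sub>R H\<^sub>0 x"] smooth_on_differentiable[OF smooth_G]
      G_sym \<Gamma>_torsion_free pd_G)
    (auto simp: G_eq matrix_mul_bilinear G\<^sub>0_def)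

section \<open>Curvature of the connection\<close>

definition "R i j x = pd i (\<Gamma> j) x - pd j (\<Gamma> i) x + \<Gamma> i x ** \<Gamma> j x - \<Gamma> j x ** \<Gamma> i x"

lemma riemann_G:
  assumes x: "x \<in> S"
  shows "riemann G l k i j x = R i j x $ l $ k"
proof -
  have "partial i (christoffel G l j k) x = pd i (\<Gamma> j) x $ l $ k" for i j
    using dird_cong_open[OF open_S x, of "christoffel G l j k" "\<lambda>y. \<Gamma> j y $ l $ k" "axis i 1"] christoffel_G
      partial_component[OF smooth_on_differentiable[OF smooth_\<Gamma> x]]
    by (simp add: partial_eq_dird)
  then show ?thesis
    by (simp add: riemann_def R_def christoffel_G[OF x] matrix_matrix_mult_def sum_subtractf)
qed

text \<open>Curvature of \<open>A\<close>: its values are endomorphisms in the flat frame, while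
  \<open>i\<close> and \<open>j\<close> remain coordinate directions of the given chart. As these
  directions commute, no bracket term occurs.\<close>

definition "F i j x = pd i (A j) x - pd j (A i) x + A i x ** A j x - A j x ** A i x"

text \<open>Differentiating the identity \<open>D_\<Gamma>\<close> avoids derivatives of \<open>W\<close>.\<close>

lemma D_R:
  assumes x: "x \<in> S"
  shows "D x ** R i j x = F i j x ** D x"
proof -
  have d: "D differentiable (at x)" "\<Gamma> k differentiable (at x)" "A k differentiable (at x)"
    "pd k D differentiable (at x)" "(\<lambda>x. A k x ** D x) differentiable (at x)" for k
    using x by (auto intro!: smooth_on_differentiable[of _ S] smooth_D smooth_\<Gamma> smooth_A smooth_on_dird
        smooth_on_bounded_bilinear[OF bounded_bilinear_matrix_mul open_S])
  have *: "D x ** pd i (\<Gamma> j) x =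
      A j x ** pd i D x + pd i (A j) x ** D x + pd i (pd j D) x - pd i D x ** \<Gamma> j x" for i j
  proof -
    have "pd i (\<lambda>x. D x ** \<Gamma> j x) x = pd i (\<lambda>x. A j x ** D x + pd j D x) x"
      by (rule dird_cong_open[OF open_S x D_\<Gamma>])
    then show ?thesis
      using dird_bounded_bilinear[OF bounded_bilinear_matrix_mul d(1) d(2)]
        dird_bounded_bilinear[OF bounded_bilinear_matrix_mul d(3) d(1)]
        dird_add[OF d(5) d(4)] by (simp add: algebra_simps)
  qed
  \<comment> \<open>The term with the derivative of \<open>D\<close> times \<open>\<Gamma>\<close>
    has the opposite sign to the one in the preceding identity; together with equality of mixed
    derivatives of \<open>D\<close> this leaves only the curvature of \<open>A\<close>.\<close>
  have **: "D x ** (\<Gamma> i x ** \<Gamma> j x) = A i x ** (A j x ** D x + pd j D x) + pd i D x ** \<Gamma> j x" for i j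
  proof -
    have "D x ** (\<Gamma> i x ** \<Gamma> j x) = (A i x ** D x + pd i D x) ** \<Gamma> j x"
      by (simp add: D_\<Gamma>[OF x] matrix_mul_assoc)
    also have "\<dots> = A i x ** (D x ** \<Gamma> j x) + pd i D x ** \<Gamma> j x"
      by (simp add: matrix_mul_bilinear matrix_mul_assoc)
    finally show ?thesis
      by (simp add: D_\<Gamma>[OF x])
  qed
  have "pd i (pd j D) x = pd j (pd i D) x"
    by (rule dird_commute[OF open_S smooth_D x])
  then show ?thesis
    unfolding R_def F_def matrix_mul_bilinear * **
    by (simp add: matrix_mul_assoc)
qed

text \<open>\<open>\<psi>\<close> is a logarithmic derivative, hence closed. Differentiating the
  product form \<open>pd_\<omega>\<close> avoids reciprocals; the extra term is a multiple of the
  symmetric \<open>\<psi> i x * \<psi> j x\<close>.\<close>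

lemma pd_\<psi>_commute:
  assumes x: "x \<in> S"
  shows "pd i (\<psi> j) x = pd j (\<psi> i) x"
proof -
  have d: "\<omega> differentiable (at x)" "\<psi> k differentiable (at x)" for k
    using x by (auto intro!: smooth_on_differentiable[of _ S] smooth_\<psi> smooth_\<omega>)
  have "pd i (pd j \<omega>) x = 2 * (\<omega> x * pd i (\<psi> j) x + pd i \<omega> x * \<psi> j x)" for i j
  proof -
    have "pd i (pd j \<omega>) x = pd i (\<lambda>x. 2 * (\<omega> x * \<psi> j x)) x"
      by (rule dird_cong_open[OF open_S x]) (simp add: pd_\<omega>)
    also have "\<dots> = 2 * pd i (\<lambda>x. \<omega> x * \<psi> j x) x"
      using d by (intro dird_bounded_linear[OF bounded_linear_mult_right] derivative_intros)
    finally show ?thesis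
      using dird_bounded_bilinear[OF bounded_bilinear_mult d] by simp
  qed
  from this[of i j] this[of j i] show ?thesis
    using dird_commute[OF open_S smooth_\<omega> x, of "axis i 1" "axis j 1"] \<omega>_nz[OF x] by (simp add: pd_\<omega>[OF x])
qed

text \<open>The classical conformal-change expression for minus the Schouten tensor, with one slot
  along a coordinate field of the given chart and the other in flat coordinates. The factor 1/2
  appears because the quadratic term of the curvature is shared by two of the four summands in
  \<open>F_eq\<close>.\<close>

definition "T i x = pd i \<phi> x - \<psi> i x *\<^sub>R \<phi> x + (\<phi> x \<bullet> (E *v \<phi> x) / 2) *\<^sub>R (E *v col i x)"

lemma F_eq:
  assumes x: "x \<in> S"
  shows "F i j x = outer (col j x) (T i x) - outer (col i x) (T j x)
    - outer (E *v T i x) (E *v col j x) + outer (E *v T j x) (E *v col i x)"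
proof -
  have d: "\<phi> differentiable (at x)" "\<psi> k differentiable (at x)" "(\<lambda>x. D x *v v) differentiable (at x)"
    "(\<lambda>x. E *v \<phi> x) differentiable (at x)" "(\<lambda>x. E *v (D x *v v)) differentiable (at x)" for k v
    using x by (auto intro!: smooth_on_differentiable[of _ S] smooth_\<psi> smooth_\<phi> smooth_col smooth_on_const
       smooth_on_bounded_bilinear[OF bounded_bilinear_matrix_vector_mul open_S])
  have Ed: "pd i (\<lambda>x. E *v f x) x = E *v pd i f x" if "f differentiable (at x)" for f i
    by (rule dird_bounded_linear[OF matrix_vector_mul_bounded_linear that])
  have pdA: "pd i (A j) x = pd i (\<psi> j) x *\<^sub>R mat 1
      + (outer (col j x) (pd i \<phi> x) + outer (pd i D x *v axis j 1) (\<phi> x))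
      - (outer (E *v \<phi> x) (E *v (pd i D x *v axis j 1)) + outer (E *v pd i \<phi> x) (E *v col j x))" for i j
  proof -
    have d': "(\<lambda>x. outer (col j x) (\<phi> x)) differentiable (at x)"
      "(\<lambda>x. outer (E *v \<phi> x) (E *v col j x)) differentiable (at x)"
      "(\<lambda>x. \<psi> j x *\<^sub>R (mat 1 :: real^'n^'n)) differentiable (at x)"
      by (rule smooth_on_differentiable[OF _ x] smooth_on_const smooth_\<phi> smooth_\<psi> smooth_col
          smooth_on_bounded_bilinear[OF bounded_bilinear_outer open_S]
          smooth_on_bounded_bilinear[OF bounded_bilinear_scaleR open_S]
          smooth_on_bounded_bilinear[OF bounded_bilinear_matrix_vector_mul open_S])+
    show ?thesis
      unfolding A_def
      using dird_diff[OF differentiable_add[OF d'(3,1)] d'(2)] dird_add[OF d'(3,1)]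
        dird_bounded_bilinear[OF bounded_bilinear_outer d(3)[of "axis j 1"] d(1)]
        dird_bounded_bilinear[OF bounded_bilinear_outer d(4) d(5)[of "axis j 1"]]
        dird_bounded_linear[OF bounded_linear_scaleR_left d(2)]
      by (simp add: Ed d pd_col[OF x])
  qed
  have sq: "A i x ** A j x = (\<psi> i x * \<psi> j x) *\<^sub>R mat 1
      + \<psi> i x *\<^sub>R (outer (col j x) (\<phi> x) - outer (E *v \<phi> x) (E *v col j x))
      + \<psi> j x *\<^sub>R (outer (col i x) (\<phi> x) - outer (E *v \<phi> x) (E *v col i x))
      + \<psi> j x *\<^sub>R outer (col i x) (\<phi> x) - (\<phi> x \<bullet> (E *v \<phi> x)) *\<^sub>R outer (col i x) (E *v col j x)
      - ((E *v col i x) \<bullet> col j x) *\<^sub>R outer (E *v \<phi> x) (\<phi> x)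
      + \<psi> i x *\<^sub>R outer (E *v \<phi> x) (E *v col j x)" for i j
    unfolding A_def
    by (simp add: matrix_mul_bilinear outer_mult_outer \<phi>_col[OF x] E_sym EEv inner_commute[of "col i x"]
        algebra_simps)
  have sym: "(E *v col i x) \<bullet> col j x = (E *v col j x) \<bullet> col i x"
    by (metis E_sym inner_commute)
  \<comment> \<open>Antisymmetrising in \<open>i\<close> and \<open>j\<close> removes the multiples
    of the identity, the derivatives of \<open>D\<close> by closedness, and the term in which
    \<open>\<phi>\<close> occurs on both sides of the outer product.\<close>
  show ?thesis
    unfolding F_def pdA sq T_def pd_\<psi>_commute[OF x, of i j] closed_D[OF x, of i j] sym
    by (simp add: outer_bilinear matrix_vector_right_distrib matrix_vector_mult_diff_distrib
        matrix_vector_mult_scaleR EEv algebra_simps flip: scaleR_add_left)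
      (simp add: vec_eq_iff)
qed

text \<open>Conjugation by \<open>D\<close> turns the columns of \<open>D\<close> into coordinate
  vectors and the flat form \<open>E\<close> into the stripped metric. This is the shape required by
  \<open>ricci_trace_vanishes\<close>, with the transpose of \<open>D\<close> applied to
  \<open>T\<close> in place of \<open>p\<close>.\<close>

lemma R_eq:
  assumes x: "x \<in> S"
  shows "R i j x = outer (axis j 1) (transpose (D x) *v T i x) - outer (axis i 1) (transpose (D x) *v T j x)
    - outer (H\<^sub>0 x *v (transpose (D x) *v T i x)) (G\<^sub>0 x *v axis j 1)
    + outer (H\<^sub>0 x *v (transpose (D x) *v T j x)) (G\<^sub>0 x *v axis i 1)"
proof -
  have "R i j x = W x ** (D x ** R i j x)"
    by (simp add: matrix_mul_assoc WD[OF x])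
  also have "\<dots> = W x ** F i j x ** D x"
    by (simp add: D_R[OF x] matrix_mul_assoc)
  finally have R: "R i j x = W x ** F i j x ** D x" .
  have Wc: "W x *v col k x = axis k 1" for k
    by (simp add: matrix_vector_mul_assoc WD[OF x])
  have "transpose (W x) ** transpose (D x) = mat 1"
    using DW[OF x] by (metis matrix_transpose_mul transpose_mat)
  then have WE: "W x *v (E *v u) = H\<^sub>0 x *v (transpose (D x) *v u)" for u
    by (simp add: H\<^sub>0_def matrix_vector_mul_assoc flip: matrix_mul_assoc del: transpose_matrix_vector)
  have DE: "transpose (D x) *v (E *v col k x) = G\<^sub>0 x *v axis k 1" for k
    by (simp add: G\<^sub>0_def matrix_vector_mul_assoc matrix_mul_assoc del: transpose_matrix_vector)
  show ?thesis
    unfolding R F_eq[OF x]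
    by (simp add: matrix_mul_bilinear mat_mult_outer outer_mult_mat Wc WE DE del: transpose_matrix_vector)
qed

text \<open>Integrability condition of the linear system \<open>dJ\<close>: differentiating it once
  more and comparing the two orders of differentiation leaves the commutator of \<open>J\<close>
  with the curvature.\<close>

lemma parallel_commutes_curvature:
  assumes J: "smooth_on J S" and par: "\<And>y m i k. y \<in> S \<Longrightarrow> nabla_endo G J m i k y = 0" and x: "x \<in> S"
  shows "J x ** R i j x = R i j x ** J x"
proof -
  have dJ: "pd m J y = J y ** \<Gamma> m y - \<Gamma> m y ** J y" if y: "y \<in> S" for m y
  proof -
    have "pd m J y $ i $ k = (J y ** \<Gamma> m y - \<Gamma> m y ** J y) $ i $ k" for i k
      using par[OF y, of m i k]
      by (simp add: nabla_endo_def partial_component[OF smooth_on_differentiable[OF J y]] christoffel_G[OF y]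
          matrix_matrix_mult_def mult.commute)
    then show ?thesis
      by (simp add: vec_eq_iff)
  qed
  have d: "J differentiable (at x)" "\<Gamma> k differentiable (at x)"
    "(\<lambda>x. J x ** \<Gamma> k x) differentiable (at x)" "(\<lambda>x. \<Gamma> k x ** J x) differentiable (at x)" for k
    using x by (auto intro!: smooth_on_differentiable[of _ S] J smooth_\<Gamma>
        smooth_on_bounded_bilinear[OF bounded_bilinear_matrix_mul open_S])
  have "pd i (pd j J) x = J x ** pd i (\<Gamma> j) x + pd i J x ** \<Gamma> j x
      - (\<Gamma> j x ** pd i J x + pd i (\<Gamma> j) x ** J x)" for i j
  proof -
    have "pd i (pd j J) x = pd i (\<lambda>y. J y ** \<Gamma> j y - \<Gamma> j y ** J y) x"
      by (rule dird_cong_open[OF open_S x dJ])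
    then show ?thesis
      using dird_diff[OF d(3,4)] dird_bounded_bilinear[OF bounded_bilinear_matrix_mul d(1) d(2)]
        dird_bounded_bilinear[OF bounded_bilinear_matrix_mul d(2) d(1)] by simp
  qed
  from this[of i j] this[of j i] show ?thesis
    using dird_commute[OF open_S J x, of "axis i 1" "axis j 1"]
    unfolding dJ[OF x]
    by (simp add: R_def matrix_mul_bilinear matrix_mul_assoc algebra_simps)
qed

theorem scalar_curvature_zero:
  assumes n: "CARD('n) > 2"
    and J: "smooth_on J S" and par: "\<And>y m i k. y \<in> S \<Longrightarrow> nabla_endo G J m i k y = 0" and x: "x \<in> S"
    and JJ: "J x ** J x = mat 1" and trJ: "trace (J x) = 0"
    and iso: "transpose (J x) ** G x ** J x = \<epsilon> *\<^sub>R G x" "\<epsilon> = 1 \<or> \<epsilon> = - 1"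
  shows "scalar_curvature G x = 0"
proof -
  have G: "G x = \<omega> x *\<^sub>R G\<^sub>0 x"
    by (simp add: G_eq[OF x] G\<^sub>0_def)
  have "(\<Sum>j\<in>UNIV. \<Sum>k\<in>UNIV. H\<^sub>0 x $ j $ k * (\<Sum>i\<in>UNIV. R i j x $ i $ k)) = 0"
  proof (rule ricci_trace_vanishes[OF n H\<^sub>0_G\<^sub>0[OF x] _ JJ trJ _ iso(2) R_eq[OF x] parallel_commutes_curvature[OF J par x]])
    show "transpose (G\<^sub>0 x) = G\<^sub>0 x"
      by (simp add: G\<^sub>0_def matrix_transpose_mul transpose_diagonal matrix_mul_assoc)
    \<comment> \<open>The isometry condition is homogeneous in the metric, so the nonzero conformal
      factor can be divided out.\<close>
    have "\<omega> x *\<^sub>R (transpose (J x) ** G\<^sub>0 x ** J x) = \<omega> x *\<^sub>R (\<epsilon> *\<^sub>R G\<^sub>0 x)"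
      using iso(1) by (simp add: G matrix_mul_bilinear mult.commute)
    then show "transpose (J x) ** G\<^sub>0 x ** J x = \<epsilon> *\<^sub>R G\<^sub>0 x"
      by (rule scaleR_left_imp_eq[OF \<omega>_nz[OF x]])
  qed
  then show ?thesis
    by (simp add: scalar_curvature_def ricci_def riemann_G[OF x] matrix_inv_G[OF x] mult.assoc
        flip: sum_distrib_left)
qed

end

section \<open>Charts and transition maps\<close>

lemma is_chart_inj: "is_chart M c \<Longrightarrow> inj_on (coords c) (chart_dom c)"
  unfolding is_chart_def
  by (metis homeomorphic_imp_injective_map openin_subset topspace_subtopology_subset)

lemma open_overlap:
  assumes "is_chart M c" "is_chart M d"
  shows "open (overlap c d)"
proof -
  have "openin (subtopology M (chart_dom c)) (chart_dom c \<inter> chart_dom d)"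
    using assms unfolding is_chart_def by (simp add: openin_subtopology_Int2)
  moreover have "open_map (subtopology M (chart_dom c)) (top_of_set (coords c ` chart_dom c)) (coords c)"
    using assms unfolding is_chart_def by (simp add: homeomorphic_imp_open_map)
  ultimately have "openin (top_of_set (coords c ` chart_dom c)) (overlap c d)"
    unfolding overlap_def open_map_def by blast
  then show ?thesis
    using assms(1) unfolding is_chart_def by (meson openin_open_trans)
qed

lemma transition_coords:
  "is_chart M c \<Longrightarrow> q \<in> chart_dom c \<Longrightarrow> transition c d (coords c q) = coords d q"
  by (simp add: transition_def is_chart_inj inv_into_f_f)

lemma transition_image: "is_chart M c \<Longrightarrow> transition c d ` overlap c d \<subseteq> overlap d c"
  by (auto simp: overlap_def transition_coords)

lemma transition_inverse:
  "is_chart M c \<Longrightarrow> is_chart M d \<Longrightarrow> x \<in> overlap c d \<Longrightarrow> transition d c (transition c d x) = x"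
  by (auto simp: overlap_def transition_coords)

lemma jacobian_mult_vec:
  fixes f :: "real^'n \<Rightarrow> real^'m"
  shows "f differentiable (at x) \<Longrightarrow> jacobian f (at x) *v v = dird v f x"
  by (rule dird_eqI[where F = "\<lambda>h. jacobian f (at x) *v h", symmetric]) (rule jacobian_works[THEN iffD1])

text \<open>Writes the Jacobian through derivatives in constant directions, from which its
  smoothness can be read off.\<close>

lemma jacobian_eq_sum_outer:
  fixes f :: "real^'n \<Rightarrow> real^'n"
  assumes "f differentiable (at x)"
  shows "jacobian f (at x) = (\<Sum>j\<in>UNIV. outer (dird (axis j 1) f x) (axis j 1))"
proof -
  have "jacobian f (at x) $ a $ b = dird (axis b 1) f x $ a" for a b
    by (simp add: matrix_vector_mult_basis column_def flip: jacobian_mult_vec[OF assms])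
  then show ?thesis
    by (simp add: vec_eq_iff outer_def axis_def if_distrib cong: if_cong)
qed

lemma smooth_on_jacobian:
  fixes f :: "real^'n \<Rightarrow> real^'n"
  assumes "open S" "smooth_on f S"
  shows "smooth_on (\<lambda>x. jacobian f (at x)) S"
proof (rule smooth_on_cong[OF assms(1)])
  show "smooth_on (\<lambda>x. \<Sum>j\<in>UNIV. outer (dird (axis j 1) f x) (axis j 1)) S"
    by (intro smooth_on_sum[OF assms(1)] smooth_on_bounded_bilinear[OF bounded_bilinear_outer assms(1)]
        smooth_on_dird[OF assms(2)] smooth_on_const)
qed (simp add: jacobian_eq_sum_outer[OF smooth_on_differentiable[OF assms(2)]])

text \<open>The rows of a Jacobian are differentials of coordinate functions, hence closed. Taking
  \<open>W\<close> as the Jacobian of the inverse transition, instead of a matrix inverse, makes its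
  smoothness a matter of composition.\<close>

lemma conformal_frame_overlap:
  fixes A :: "('a, 'n::finite) chart set"
  assumes man: "smooth_manifold M A" and g: "bilinear_field A g" and c: "c \<in> A" and d: "d \<in> A"
    and e: "\<And>k. e k \<in> {1, -1}"
    and flat: "\<And>y. y \<in> coords d ` chart_dom d \<Longrightarrow> \<Omega> y \<noteq> 0 \<and> g d y = (\<Omega> y)\<^sup>2 *\<^sub>R diagonal e"
  shows "conformal_frame (overlap c d) (\<lambda>x. (\<Omega> (transition c d x))\<^sup>2)
    (\<lambda>x. jacobian (transition c d) (at x)) (\<lambda>x. jacobian (transition d c) (at (transition c d x))) e (g c)"
proof -
  define S where "S = overlap c d"
  define f where "f = transition c d"
  define k where "k = transition d c"
  have charts: "is_chart M c" "is_chart M d"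
    using man c d by (auto simp: smooth_manifold_def)
  have S: "open S" and T: "open (overlap d c)"
    using open_overlap[OF charts] open_overlap[OF charts(2,1)] by (simp_all add: S_def)
  have f: "smooth_on f S" and k: "smooth_on k (overlap d c)"
    using man c d by (auto simp: smooth_manifold_def compatible_def S_def f_def k_def)
  have fS: "f ` S \<subseteq> overlap d c"
    using transition_image charts by (simp add: f_def S_def)
  have T_sub: "overlap d c \<subseteq> coords d ` chart_dom d"
    by (auto simp: overlap_def)
  note df = smooth_on_differentiable[OF f] and dk = smooth_on_differentiable[OF k]
  have smooth_f: "smooth_on (\<lambda>x. jacobian f (at x)) S"
    by (rule smooth_on_jacobian[OF S f])
  have \<Omega>: "\<Omega> (f x) \<noteq> 0" "g d (f x) = (\<Omega> (f x))\<^sup>2 *\<^sub>R diagonal e" if "x \<in> S" for x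
    using that flat fS T_sub by blast+
  show ?thesis
    unfolding S_def[symmetric] f_def[symmetric] k_def[symmetric]
  proof
    fix i l and x assume x: "x \<in> S"
    then have fx: "f x \<in> overlap d c"
      using fS by blast
    show "(\<Omega> (f x))\<^sup>2 \<noteq> 0"
      using \<Omega>[OF x] by simp
    have "jacobian k (at (f x)) *v (jacobian f (at x) *v v) = v" for v
    proof -
      have "jacobian k (at (f x)) *v (jacobian f (at x) *v v) = dird v (\<lambda>x. k (f x)) x"
        by (simp add: jacobian_mult_vec[OF df[OF x]] jacobian_mult_vec[OF dk[OF fx]]
            dird_compose[OF df[OF x] dk[OF fx]])
      also have "\<dots> = dird v (\<lambda>x. x) x"
        using transition_inverse[OF charts]
        by (intro dird_cong_open[OF S x]) (simp add: f_def k_def S_def)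
      finally show ?thesis
        by (simp add: dird_def)
    qed
    then show "jacobian k (at (f x)) ** jacobian f (at x) = mat 1"
      by (simp add: matrix_eq matrix_vector_mul_assoc)
    \<comment> \<open>Both sides are second derivatives of the transition map, so closedness reduces
      to \<open>dird_commute\<close>.\<close>
    have "dird (axis i 1) (\<lambda>x. jacobian f (at x)) x *v v = dird (axis i 1) (dird v f) x" for i v
    proof -
      have "dird (axis i 1) (dird v f) x = dird (axis i 1) (\<lambda>x. jacobian f (at x) *v v) x"
        by (rule dird_cong_open[OF S x]) (simp add: jacobian_mult_vec[OF df])
      then show ?thesis
        using dird_bounded_linear[OF bounded_bilinear.bounded_linear_left[OF bounded_bilinear_matrix_vector_mul]
            smooth_on_differentiable[OF smooth_f x]] by metis
    qed
    then show "dird (axis i 1) (\<lambda>x. jacobian f (at x)) x *v axis l 1 =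
        dird (axis l 1) (\<lambda>x. jacobian f (at x)) x *v axis i 1"
      using dird_commute[OF S f x] by metis
    have "g c x = transpose (jacobian f (at x)) ** g d (f x) ** jacobian f (at x)"
      using g c d x by (auto simp: bilinear_field_def f_def S_def)
    then show "g c x = (\<Omega> (f x))\<^sup>2 *\<^sub>R (transpose (jacobian f (at x)) ** diagonal e ** jacobian f (at x))"
      by (simp add: \<Omega>[OF x] matrix_mul_bilinear)
  next
    fix i
    \<comment> \<open>Conformal flatness provides \<Omega> as a bare function. Its square is smooth
      because it is, up to the sign \<open>e i\<close>, a diagonal entry of the metric.\<close>
    have "smooth_on (\<lambda>x. g d (f x)) S"
      using smooth_on_compose[OF S _ f] fS T_sub g d unfolding bilinear_field_def by blast
    then have "smooth_on (\<lambda>x. e i * g d (f x) $ i $ i) S"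
      using smooth_on_bounded_linear[OF bounded_linear_component2 S]
        smooth_on_bounded_linear[OF bounded_linear_mult_right S] by blast
    moreover have "e i * g d (f x) $ i $ i = (\<Omega> (f x))\<^sup>2" if "x \<in> S" for x
      using e[of i] \<Omega>[OF that] by (auto simp: diagonal_def)
    ultimately show "smooth_on (\<lambda>x. (\<Omega> (f x))\<^sup>2) S"
      using smooth_on_cong[OF S] by (metis (no_types, lifting))
  next
    show "smooth_on (\<lambda>x. jacobian k (at (f x))) S"
      using smooth_on_compose[OF S fS f smooth_on_jacobian[OF T k]] .
  qed (use S smooth_f e in auto)
qed

lemma matrix_eqI_inner:
  fixes M N :: "real^'n^'n"
  assumes "\<And>v w. v \<bullet> (M *v w) = v \<bullet> (N *v w)"
  shows "M = N"
  using assms by (metis matrix_eq vector_eq_rdot inner_commute)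

theorem theorem2:
  fixes M :: "'a topology" and A :: "('a, 4) chart set" and g :: "('a, 4) field2"
  assumes "smooth_manifold M A"
    and "metric_of_signature A g 2 2"
    and "conformally_flat M A g"
    and "(\<exists>j. almost_paracomplex A j \<and> parallel A g j \<and> anti_isometric A g j) \<or>
         (\<exists>j. almost_paracomplex A j \<and> parallel A g j \<and> isometric A g j)"
  shows "\<forall>p\<in>topspace M. \<forall>c\<in>A. p \<in> chart_dom c \<longrightarrow> scalar_curvature (g c) (coords c p) = 0"
proof (intro ballI impI)
  fix p c assume p: "p \<in> topspace M" and c: "c \<in> A" and pc: "p \<in> chart_dom c"
  obtain d \<Omega> e where d: "d \<in> A" "p \<in> chart_dom d" and e: "\<And>k. e k \<in> {1, -1}"
    and flat: "\<And>y. y \<in> coords d ` chart_dom d \<Longrightarrow> \<Omega> y \<noteq> 0 \<and> g d y = (\<Omega> y)\<^sup>2 *\<^sub>R diagonal e"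
    using assms(3) p unfolding conformally_flat_def by metis
  \<comment> \<open>Both kinds of structure are treated at once by the sign \<epsilon>.\<close>
  obtain j \<epsilon> where j: "almost_paracomplex A j" and par: "parallel A g j" and \<epsilon>: "\<epsilon> = 1 \<or> \<epsilon> = - 1"
    and iso: "\<And>x v w. x \<in> coords c ` chart_dom c \<Longrightarrow>
      (j c x *v v) \<bullet> (g c x *v (j c x *v w)) = \<epsilon> * (v \<bullet> (g c x *v w))"
    using assms(4)
  proof
    assume "\<exists>j. almost_paracomplex A j \<and> parallel A g j \<and> anti_isometric A g j"
    then obtain j where j: "almost_paracomplex A j" "parallel A g j" "anti_isometric A g j"
      by blast
    show thesis
    proof (rule that[OF j(1,2)])
      show "(j c x *v v) \<bullet> (g c x *v (j c x *v w)) = - 1 * (v \<bullet> (g c x *v w))"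
        if "x \<in> coords c ` chart_dom c" for x v w
        using j(3) c that unfolding anti_isometric_def by fastforce
    qed simp
  next
    assume "\<exists>j. almost_paracomplex A j \<and> parallel A g j \<and> isometric A g j"
    then obtain j where j: "almost_paracomplex A j" "parallel A g j" "isometric A g j"
      by blast
    show thesis
    proof (rule that[OF j(1,2)])
      show "(j c x *v v) \<bullet> (g c x *v (j c x *v w)) = 1 * (v \<bullet> (g c x *v w))"
        if "x \<in> coords c ` chart_dom c" for x v w
        using j(3) c that unfolding isometric_def by fastforce
    qed simp
  qed
  have sub: "overlap c d \<subseteq> coords c ` chart_dom c"
    by (auto simp: overlap_def)
  have x: "coords c p \<in> overlap c d" and x': "coords c p \<in> coords c ` chart_dom c"
    using pc d(2) by (auto simp: overlap_def)
  let ?J = "j c (coords c p)" and ?G = "g c (coords c p)"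
  have J: "?J ** ?J = mat 1" "dim {v. ?J *v v = v} = 2" "dim {v. ?J *v v = - v} = 2"
    and smooth: "smooth_on (j c) (coords c ` chart_dom c)"
    using j c x' by (auto simp: almost_paracomplex_def endomorphism_field_def)
  \<comment> \<open>The claim is pointwise, so it suffices to work on the overlap of the arbitrary
    chart \<open>c\<close> with a flat chart around \<open>p\<close>.\<close>
  interpret conformal_frame "overlap c d" "\<lambda>x. (\<Omega> (transition c d x))\<^sup>2"
    "\<lambda>x. jacobian (transition c d) (at x)" "\<lambda>x. jacobian (transition d c) (at (transition c d x))" e "g c"
    using assms(1,2) c d(1) e flat by (intro conformal_frame_overlap) (auto simp: metric_of_signature_def)
  have "transpose ?J ** ?G ** ?J = \<epsilon> *\<^sub>R ?G"
    using iso[OF x']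
    by (intro matrix_eqI_inner) (simp add: inner_matrix_vector_transpose matrix_vector_mul_assoc matrix_mul_assoc
        flip: scaleR_matrix_vector_assoc del: transpose_matrix_vector)
  moreover have "nabla_endo (g c) (j c) m i k y = 0" if "y \<in> overlap c d" for y m i k
    using par c that sub by (auto simp: parallel_def)
  ultimately show "scalar_curvature (g c) (coords c p) = 0"
    using smooth_on_subset[OF smooth sub] J trace_involution_zero[OF J] x \<epsilon>
    by (intro scalar_curvature_zero) auto
qed

end
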